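(* Let $\alpha>-1$. The space $L^2(\mathbb{D},\mu_\alpha)$ is the orthogonal sum of the subspaces $\mathcal{W}_\xi^{(\alpha)}$: $$L^2(\mathbb{D},\mu_\alpha)=\bigoplus_{\xi\in\mathbb{Z}}\mathcal{W}_\xi^{(\alpha)}.$$
   Context: $\mathbb{N}_0=\{0,1,2,\dots\}$, $\mathbb{D}$ is the open unit disk. The measure $\mu_\alpha$ on $\mathbb{D}$ is $\mathrm{d}\mu_\alpha(z)=\frac{\alpha+1}{\pi}(1-|z|^2)^\alpha\,\mathrm{d}\mu(z)$, where $\mu$ is Lebesgue plane measure. Put $m_{p,q}(z)=z^p\overline{z}^q$ for $p,q\in\mathbb{N}_0$. For $\xi\in\mathbb{Z}$, $\mathcal{W}_\xi^{(\alpha)}$ is the closure in $L^2(\mathbb{D},\mu_\alpha)$ of $\operatorname{span}\{m_{p,q}:\ p,q\in\mathbb{N}_0,\ p-q=\xi\}$. *)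

theory Defs
  imports "HOL-Analysis.Analysis"
begin

text \<open>
  The space \<open>L\<^sup>2(M)\<close> is represented by its square integrable functions; two functions
  that agree almost everywhere stand for the same element. The functions in an
  \<open>L\<^sup>2\<close>-closure are thus determined only up to almost everywhere equality, and their values
  outside the space of \<open>M\<close> are irrelevant.
\<close>

definition square_integrable_set :: "'a measure \<Rightarrow> ('a \<Rightarrow> complex) set" where
  "square_integrable_set M = {f \<in> borel_measurable M. integrable M (\<lambda>x. (cmod (f x))\<^sup>2)}"

definition L2_inner :: "'a measure \<Rightarrow> ('a \<Rightarrow> complex) \<Rightarrow> ('a \<Rightarrow> complex) \<Rightarrow> complex" where
  "L2_inner M f g = (\<integral>x. f x * cnj (g x) \<partial>M)"

definition L2_norm :: "'a measure \<Rightarrow> ('a \<Rightarrow> complex) \<Rightarrow> real" where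
  "L2_norm M f = sqrt (\<integral>x. (cmod (f x))\<^sup>2 \<partial>M)"

definition L2_closure :: "'a measure \<Rightarrow> ('a \<Rightarrow> complex) set \<Rightarrow> ('a \<Rightarrow> complex) set" where
  "L2_closure M S =
     {f \<in> square_integrable_set M. \<forall>e>0. \<exists>g \<in> S \<inter> square_integrable_set M. L2_norm M (\<lambda>x. f x - g x) < e}"

definition fun_span :: "('a \<Rightarrow> complex) set \<Rightarrow> ('a \<Rightarrow> complex) set" where
  "fun_span S = {(\<lambda>x. \<Sum>g\<in>F. c g * g x) | F c. finite F \<and> F \<subseteq> S}"

definition L2_closed_subspace :: "'a measure \<Rightarrow> ('a \<Rightarrow> complex) set \<Rightarrow> bool" where
  "L2_closed_subspace M V \<longleftrightarrow>
     V \<subseteq> square_integrable_set M \<and>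
     (\<lambda>x. 0) \<in> V \<and>
     (\<forall>f\<in>V. \<forall>g\<in>V. (\<lambda>x. f x + g x) \<in> V) \<and>
     (\<forall>c. \<forall>f\<in>V. (\<lambda>x. c * f x) \<in> V) \<and>
     L2_closure M V = V"

text \<open>
  \<open>L\<^sup>2(M)\<close> is the (Hilbert space) orthogonal sum of the family \<open>V\<close>: the \<open>V i\<close> are pairwise
  orthogonal closed subspaces, and every element is the unconditional \<open>L\<^sup>2\<close>-sum of a family
  of components in the \<open>V i\<close>. The components are then unique (almost everywhere) by
  orthogonality.
\<close>

definition L2_orthogonal_sum ::
    "'a measure \<Rightarrow> 'i set \<Rightarrow> ('i \<Rightarrow> ('a \<Rightarrow> complex) set) \<Rightarrow> bool" where
  "L2_orthogonal_sum M I V \<longleftrightarrow>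
     (\<forall>i\<in>I. L2_closed_subspace M (V i)) \<and>
     (\<forall>i\<in>I. \<forall>j\<in>I. i \<noteq> j \<longrightarrow> (\<forall>f\<in>V i. \<forall>g\<in>V j. L2_inner M f g = 0)) \<and>
     (\<forall>f\<in>square_integrable_set M. \<exists>h. (\<forall>i\<in>I. h i \<in> V i) \<and>
        ((\<lambda>F. L2_norm M (\<lambda>x. f x - (\<Sum>i\<in>F. h i x))) \<longlongrightarrow> 0) (finite_subsets_at_top I))"

definition disk_measure :: "real \<Rightarrow> complex measure" where
  "disk_measure \<alpha> =
     density (lebesgue_on (ball 0 1)) (\<lambda>z. ennreal ((\<alpha> + 1) / pi * (1 - (cmod z)\<^sup>2) powr \<alpha>))"

definition disk_monomial :: "nat \<Rightarrow> nat \<Rightarrow> complex \<Rightarrow> complex" where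
  "disk_monomial p q z = z ^ p * cnj z ^ q"

definition W_space :: "real \<Rightarrow> int \<Rightarrow> (complex \<Rightarrow> complex) set" where
  "W_space \<alpha> \<xi> = L2_closure (disk_measure \<alpha>)
     (fun_span {disk_monomial p q | p q. int p - int q = \<xi>})"

end

theory Submission
  imports Defs
begin

text \<open>
  Rotation invariance of \<open>\<mu>\<^sub>\<alpha>\<close> makes monomials with different \<open>p - q\<close> orthogonal. All
  monomials together span a dense subspace: by Stone--Weierstrass its closure contains the continuous
  functions, hence the indicators of open sets, of Borel sets and of Lebesgue sets, and so all of
  \<open>L\<^sup>2\<close>. Given polynomials \<open>g\<^sub>n\<close> converging to \<open>f\<close>, Pythagoras shows that their components of
  each degree \<open>\<xi>\<close> are Cauchy; by the completeness of \<open>L\<^sup>2\<close> the components have limits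
  \<open>h\<^sub>\<xi>\<close>, and \<open>f\<close> is the sum of the \<open>h\<^sub>\<xi>\<close>. No orthogonal projections are needed.
\<close>

section \<open>Square integrable functions\<close>

text \<open>Convergence in \<open>L2_orthogonal_sum\<close> runs along the net of all finite index
  sets, whereas density supplies only a sequence of approximants, each with its own finite set of
  degrees. The gap is closed by the fact that omitting orthogonal summands never increases the norm:
  an error bound on one large index set holds on every smaller one, so the estimates are uniform in
  the index set. The measure lives on Lebesgue sets, while Fubini, image measures and affine
  substitutions are applied to Borel functions; monomials are Borel, so rotation invariance is
  proved for Borel integrands. A rotation is split into two one-dimensional substitutions, which
  excludes \<open>Re w = 0\<close>; this restriction dictates the angle chosen for orthogonality.
  The hypothesis \<open>\<alpha> > -1\<close> acts through finiteness of the measure: bounded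
  measurable functions are then square integrable, and constants can dominate uniform approximations
  and indicators.\<close>

lemma borel_measurable_cnj [measurable]: "cnj \<in> borel_measurable borel"
  by (intro borel_measurable_continuous_onI continuous_intros)

lemma square_integrable_integrable:
  "f \<in> square_integrable_set M \<Longrightarrow> integrable M (\<lambda>x. (cmod (f x))\<^sup>2)"
  by (simp add: square_integrable_set_def)

lemma square_integrable_zero [simp]: "(\<lambda>x. 0) \<in> square_integrable_set M"
  by (simp add: square_integrable_set_def)

lemma square_integrable_cmult:
  "f \<in> square_integrable_set M \<Longrightarrow> (\<lambda>x. c * f x) \<in> square_integrable_set M"
  by (auto simp: square_integrable_set_def norm_mult power_mult_distrib)

lemma square_integrable_add:
  assumes "f \<in> square_integrable_set M" "g \<in> square_integrable_set M"
  shows "(\<lambda>x. f x + g x) \<in> square_integrable_set M"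
proof -
  have [measurable]: "f \<in> borel_measurable M" "g \<in> borel_measurable M"
    using assms by (auto simp: square_integrable_set_def)
  have "integrable M (\<lambda>x. (cmod (f x + g x))\<^sup>2)"
  proof (rule Bochner_Integration.integrable_bound)
    show "integrable M (\<lambda>x. 2 * (cmod (f x))\<^sup>2 + 2 * (cmod (g x))\<^sup>2)"
      using assms by (auto simp: square_integrable_set_def)
    have "(cmod (f x + g x))\<^sup>2 \<le> 2 * (cmod (f x))\<^sup>2 + 2 * (cmod (g x))\<^sup>2" for x
    proof -
      have "(cmod (f x + g x))\<^sup>2 \<le> (cmod (f x) + cmod (g x))\<^sup>2"
        by (intro power_mono norm_triangle_ineq) auto
      also have "\<dots> \<le> 2 * (cmod (f x))\<^sup>2 + 2 * (cmod (g x))\<^sup>2"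
        using sum_squares_bound[of "cmod (f x)" "cmod (g x)"] by (simp add: power2_sum)
      finally show ?thesis .
    qed
    then show "AE x in M. norm ((cmod (f x + g x))\<^sup>2)
        \<le> norm (2 * (cmod (f x))\<^sup>2 + 2 * (cmod (g x))\<^sup>2)"
      by (auto intro!: AE_I2 order_trans[OF _ abs_ge_self])
  qed simp
  then show ?thesis by (simp add: square_integrable_set_def)
qed

lemma square_integrable_diff:
  assumes "f \<in> square_integrable_set M" "g \<in> square_integrable_set M"
  shows "(\<lambda>x. f x - g x) \<in> square_integrable_set M"
  using square_integrable_add[OF assms(1) square_integrable_cmult[OF assms(2), of "-1"]] by simp

lemma square_integrable_sum:
  assumes "\<And>i. i \<in> F \<Longrightarrow> u i \<in> square_integrable_set M"
  shows "(\<lambda>x. \<Sum>i\<in>F. u i x) \<in> square_integrable_set M"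
  using assms by (induction F rule: infinite_finite_induct) (auto intro: square_integrable_add)

lemma square_integrable_mult_integrable:
  assumes "f \<in> square_integrable_set M" "g \<in> square_integrable_set M"
  shows "integrable M (\<lambda>x. f x * cnj (g x))"
proof (rule Bochner_Integration.integrable_bound)
  show "integrable M (\<lambda>x. (cmod (f x))\<^sup>2 + (cmod (g x))\<^sup>2)"
    using assms by (auto simp: square_integrable_set_def)
  have [measurable]: "f \<in> borel_measurable M" "g \<in> borel_measurable M"
    using assms by (auto simp: square_integrable_set_def)
  show "(\<lambda>x. f x * cnj (g x)) \<in> borel_measurable M" by measurable
  have "cmod (f x) * cmod (g x) \<le> (cmod (f x))\<^sup>2 + (cmod (g x))\<^sup>2" for x
    using sum_squares_bound[of "cmod (f x)" "cmod (g x)"]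
      mult_nonneg_nonneg[of "cmod (f x)" "cmod (g x)"] norm_ge_zero[of "f x"] norm_ge_zero[of "g x"]
    by linarith
  then show "AE x in M. norm (f x * cnj (g x)) \<le> norm ((cmod (f x))\<^sup>2 + (cmod (g x))\<^sup>2)"
    by (auto intro!: AE_I2 simp: norm_mult)
qed

section \<open>The norm: Cauchy-Schwarz and triangle inequality\<close>

lemma L2_norm_nonneg [simp]: "0 \<le> L2_norm M f"
  by (simp add: L2_norm_def)

lemma L2_norm_power2: "(L2_norm M f)\<^sup>2 = (\<integral>x. (cmod (f x))\<^sup>2 \<partial>M)"
  by (simp add: L2_norm_def)

lemma L2_norm_power2_nn:
  assumes "f \<in> square_integrable_set M"
  shows "(\<integral>\<^sup>+x. ennreal ((cmod (f x))\<^sup>2) \<partial>M) = ennreal ((L2_norm M f)\<^sup>2)"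
  unfolding L2_norm_power2
  by (rule nn_integral_eq_integral) (use assms in \<open>auto simp: square_integrable_set_def\<close>)

text \<open>Made for the output of Fatou's lemma in \<open>L2_complete\<close>: a bound on a
  nonnegative integral, from which integrability itself has to be drawn together with the norm
  estimate.\<close>

lemma square_integrable_nnI:
  assumes [measurable]: "f \<in> borel_measurable M"
    and le: "(\<integral>\<^sup>+x. ennreal ((cmod (f x))\<^sup>2) \<partial>M) \<le> ennreal (e\<^sup>2)" and e: "e \<ge> 0"
  shows "f \<in> square_integrable_set M" "L2_norm M f \<le> e"
proof -
  have "integrable M (\<lambda>x. (cmod (f x))\<^sup>2)"
    by (rule integrableI_nonneg) (use le in \<open>auto simp: less_top[symmetric] top_unique\<close>)
  then show f: "f \<in> square_integrable_set M" by (simp add: square_integrable_set_def)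
  have "(L2_norm M f)\<^sup>2 \<le> e\<^sup>2" using le by (simp add: L2_norm_power2_nn[OF f])
  then show "L2_norm M f \<le> e" using e by (rule power2_le_imp_le)
qed

lemma L2_norm_cmult: "L2_norm M (\<lambda>x. c * f x) = cmod c * L2_norm M f"
  by (simp add: L2_norm_def norm_mult power_mult_distrib real_sqrt_mult)

lemma L2_norm_zero [simp]: "L2_norm M (\<lambda>x. 0) = 0"
  by (simp add: L2_norm_def)

lemma L2_norm_minus_commute: "L2_norm M (\<lambda>x. f x - g x) = L2_norm M (\<lambda>x. g x - f x)"
  by (simp add: L2_norm_def norm_minus_commute)

text \<open>Cauchy-Schwarz for absolute values, transferred from nonnegative integrals; this form
  serves both the bound on \<open>L2_inner\<close> and the cross term in the triangle
  inequality.\<close>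

lemma integral_norm_mult_le_L2_norm:
  assumes f: "f \<in> square_integrable_set M" and g: "g \<in> square_integrable_set M"
  shows "(\<integral>x. cmod (f x) * cmod (g x) \<partial>M) \<le> L2_norm M f * L2_norm M g"
proof -
  have [measurable]: "f \<in> borel_measurable M" "g \<in> borel_measurable M"
    using f g by (auto simp: square_integrable_set_def)
  have int: "integrable M (\<lambda>x. cmod (f x) * cmod (g x))"
    using integrable_norm[OF square_integrable_mult_integrable[OF f g]] by (simp add: norm_mult)
  have "(\<integral>\<^sup>+x. ennreal (cmod (f x)) * ennreal (cmod (g x)) \<partial>M)\<^sup>2
      \<le> (\<integral>\<^sup>+x. (ennreal (cmod (f x)))\<^sup>2 \<partial>M) * (\<integral>\<^sup>+x. (ennreal (cmod (g x)))\<^sup>2 \<partial>M)"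
    by (rule Cauchy_Schwarz_nn_integral) auto
  also have "\<dots> = ennreal ((L2_norm M f)\<^sup>2) * ennreal ((L2_norm M g)\<^sup>2)"
    by (simp add: ennreal_power L2_norm_power2_nn f g)
  also have "\<dots> = ennreal ((L2_norm M f * L2_norm M g)\<^sup>2)"
    by (simp add: ennreal_mult' power_mult_distrib)
  also have "(\<integral>\<^sup>+x. ennreal (cmod (f x)) * ennreal (cmod (g x)) \<partial>M)
      = ennreal (\<integral>x. cmod (f x) * cmod (g x) \<partial>M)"
    by (subst nn_integral_eq_integral[OF int, symmetric]) (auto simp: ennreal_mult')
  finally have "(\<integral>x. cmod (f x) * cmod (g x) \<partial>M)\<^sup>2 \<le> (L2_norm M f * L2_norm M g)\<^sup>2"
    by (simp add: ennreal_power)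
  then show ?thesis by (rule power2_le_imp_le) simp
qed

lemma L2_Cauchy_Schwarz:
  assumes f: "f \<in> square_integrable_set M" and g: "g \<in> square_integrable_set M"
  shows "cmod (L2_inner M f g) \<le> L2_norm M f * L2_norm M g"
proof -
  have "cmod (L2_inner M f g) \<le> (\<integral>x. cmod (f x * cnj (g x)) \<partial>M)"
    unfolding L2_inner_def by (rule integral_norm_bound)
  also have "\<dots> \<le> L2_norm M f * L2_norm M g"
    using integral_norm_mult_le_L2_norm[OF f g] by (simp add: norm_mult)
  finally show ?thesis .
qed

lemma L2_norm_triangle:
  assumes f: "f \<in> square_integrable_set M" and g: "g \<in> square_integrable_set M"
  shows "L2_norm M (\<lambda>x. f x + g x) \<le> L2_norm M f + L2_norm M g"
proof -
  have int: "integrable M (\<lambda>x. cmod (f x) * cmod (g x))"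
    using integrable_norm[OF square_integrable_mult_integrable[OF f g]] by (simp add: norm_mult)
  note ints = int square_integrable_integrable[OF f] square_integrable_integrable[OF g]
  have "(L2_norm M (\<lambda>x. f x + g x))\<^sup>2 \<le>
      (\<integral>x. (cmod (f x))\<^sup>2 + 2 * (cmod (f x) * cmod (g x)) + (cmod (g x))\<^sup>2 \<partial>M)"
    unfolding L2_norm_power2
  proof (rule integral_mono)
    show "integrable M (\<lambda>x. (cmod (f x + g x))\<^sup>2)"
      by (rule square_integrable_integrable[OF square_integrable_add[OF f g]])
    show "(cmod (f x + g x))\<^sup>2 \<le> (cmod (f x))\<^sup>2 + 2 * (cmod (f x) * cmod (g x)) + (cmod (g x))\<^sup>2" for x
      using power_mono[OF norm_triangle_ineq[of "f x" "g x"] norm_ge_zero, of 2]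
      by (simp add: power2_sum algebra_simps)
  qed (use ints in auto)
  also have "\<dots> = (L2_norm M f)\<^sup>2 + 2 * (\<integral>x. cmod (f x) * cmod (g x) \<partial>M) + (L2_norm M g)\<^sup>2"
    using ints by (simp add: L2_norm_power2)
  also have "\<dots> \<le> (L2_norm M f + L2_norm M g)\<^sup>2"
    using integral_norm_mult_le_L2_norm[OF f g] by (simp add: power2_sum)
  finally show ?thesis by (rule power2_le_imp_le) simp
qed

lemma L2_norm_triangle_diff:
  assumes "f \<in> square_integrable_set M" "g \<in> square_integrable_set M" "h \<in> square_integrable_set M"
  shows "L2_norm M (\<lambda>x. f x - h x) \<le> L2_norm M (\<lambda>x. f x - g x) + L2_norm M (\<lambda>x. g x - h x)"
  using L2_norm_triangle[OF square_integrable_diff[OF assms(1,2)] square_integrable_diff[OF assms(2,3)]]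
  by simp

lemma L2_norm_sum_le:
  assumes "\<And>i. i \<in> F \<Longrightarrow> u i \<in> square_integrable_set M"
  shows "L2_norm M (\<lambda>x. \<Sum>i\<in>F. u i x) \<le> (\<Sum>i\<in>F. L2_norm M (u i))"
  using assms
proof (induction F rule: infinite_finite_induct)
  case (insert i F)
  have "L2_norm M (\<lambda>x. u i x + (\<Sum>i\<in>F. u i x)) \<le> L2_norm M (u i) + L2_norm M (\<lambda>x. \<Sum>i\<in>F. u i x)"
    by (intro L2_norm_triangle square_integrable_sum insert.prems) auto
  with insert show ?case by (force simp: add_left_mono)
qed auto

section \<open>The inner product and Pythagoras\<close>

lemma L2_inner_add_left:
  assumes "f \<in> square_integrable_set M" "g \<in> square_integrable_set M" "h \<in> square_integrable_set M"
  shows "L2_inner M (\<lambda>x. f x + g x) h = L2_inner M f h + L2_inner M g h"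
  using square_integrable_mult_integrable[OF assms(1,3)] square_integrable_mult_integrable[OF assms(2,3)]
  by (simp add: L2_inner_def distrib_right)

lemma L2_inner_cmult_left: "L2_inner M (\<lambda>x. c * f x) h = c * L2_inner M f h"
  by (simp add: L2_inner_def mult.assoc)

lemma L2_inner_commute: "L2_inner M g f = cnj (L2_inner M f g)"
  unfolding L2_inner_def by (subst Bochner_Integration.integral_cnj[symmetric]) (simp add: mult.commute)

lemma L2_inner_zero_left [simp]: "L2_inner M (\<lambda>x. 0) f = 0"
  by (simp add: L2_inner_def)

lemma L2_inner_sum_left:
  assumes "\<And>i. i \<in> F \<Longrightarrow> u i \<in> square_integrable_set M" "h \<in> square_integrable_set M"
  shows "L2_inner M (\<lambda>x. \<Sum>i\<in>F. u i x) h = (\<Sum>i\<in>F. L2_inner M (u i) h)"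
  using assms
  by (induction F rule: infinite_finite_induct)
     (auto simp: L2_inner_add_left square_integrable_sum)

lemma L2_pythagoras:
  assumes f: "f \<in> square_integrable_set M" and g: "g \<in> square_integrable_set M"
    and orth: "L2_inner M f g = 0"
  shows "(L2_norm M (\<lambda>x. f x + g x))\<^sup>2 = (L2_norm M f)\<^sup>2 + (L2_norm M g)\<^sup>2"
proof -
  \<comment> \<open>The cross term is kept as the real part of one complex integrand, so that its
    integral is the real part of twice the inner product, hence zero.\<close>
  have eq: "(cmod (f x + g x))\<^sup>2 = (cmod (f x))\<^sup>2 + (cmod (g x))\<^sup>2 + Re (f x * cnj (g x) + f x * cnj (g x))" for x
    unfolding cmod_power2 by (simp add: power2_eq_square algebra_simps)
  have int: "integrable M (\<lambda>x. f x * cnj (g x))"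
    by (rule square_integrable_mult_integrable[OF f g])
  then have int': "integrable M (\<lambda>x. f x * cnj (g x) + f x * cnj (g x))" by auto
  have "(\<integral>x. Re (f x * cnj (g x) + f x * cnj (g x)) \<partial>M) = 0"
    unfolding integral_Re[OF int'] using orth int by (simp add: L2_inner_def)
  moreover have "integrable M (\<lambda>x. Re (f x * cnj (g x) + f x * cnj (g x)))"
    using int' by (rule integrable_Re)
  ultimately show ?thesis
    unfolding L2_norm_power2 eq
    using square_integrable_integrable[OF f] square_integrable_integrable[OF g]
    by (simp del: plus_complex.simps)
qed

lemma L2_pythagoras_sum:
  assumes "finite F"
    and "\<And>i. i \<in> F \<Longrightarrow> u i \<in> square_integrable_set M"
    and "\<And>i j. i \<in> F \<Longrightarrow> j \<in> F \<Longrightarrow> i \<noteq> j \<Longrightarrow> L2_inner M (u i) (u j) = 0"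
  shows "(L2_norm M (\<lambda>x. \<Sum>i\<in>F. u i x))\<^sup>2 = (\<Sum>i\<in>F. (L2_norm M (u i))\<^sup>2)"
  using assms
proof (induction F rule: finite_induct)
  case (insert i F)
  have "L2_inner M (\<lambda>x. \<Sum>j\<in>F. u j x) (u i) = (\<Sum>j\<in>F. L2_inner M (u j) (u i))"
    by (intro L2_inner_sum_left insert.prems) auto
  also have "\<dots> = 0"
    using insert.hyps insert.prems(2) by (intro sum.neutral) blast
  finally have "L2_inner M (u i) (\<lambda>x. \<Sum>j\<in>F. u j x) = 0"
    by (subst L2_inner_commute) simp
  then have "(L2_norm M (\<lambda>x. u i x + (\<Sum>j\<in>F. u j x)))\<^sup>2
      = (L2_norm M (u i))\<^sup>2 + (L2_norm M (\<lambda>x. \<Sum>j\<in>F. u j x))\<^sup>2"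
    by (intro L2_pythagoras square_integrable_sum insert.prems) auto
  with insert show ?case by simp
qed simp

text \<open>By Pythagoras both squared norms are sums of nonnegative terms, and \<open>F\<close>
  merely has fewer of them. This is what later makes error bounds independent of the index
  set.\<close>

lemma L2_norm_orthogonal_sum_mono:
  assumes "finite G" "F \<subseteq> G"
    and "\<And>i. i \<in> G \<Longrightarrow> u i \<in> square_integrable_set M"
    and "\<And>i j. i \<in> G \<Longrightarrow> j \<in> G \<Longrightarrow> i \<noteq> j \<Longrightarrow> L2_inner M (u i) (u j) = 0"
  shows "L2_norm M (\<lambda>x. \<Sum>i\<in>F. u i x) \<le> L2_norm M (\<lambda>x. \<Sum>i\<in>G. u i x)"
proof -
  have "finite F" by (rule finite_subset[OF assms(2,1)])
  then have "(L2_norm M (\<lambda>x. \<Sum>i\<in>F. u i x))\<^sup>2 = (\<Sum>i\<in>F. (L2_norm M (u i))\<^sup>2)"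
    using \<open>F \<subseteq> G\<close> by (intro L2_pythagoras_sum assms) auto
  also have "\<dots> \<le> (\<Sum>i\<in>G. (L2_norm M (u i))\<^sup>2)"
    using assms by (intro sum_mono2) auto
  also have "\<dots> = (L2_norm M (\<lambda>x. \<Sum>i\<in>G. u i x))\<^sup>2"
    using assms by (intro L2_pythagoras_sum[symmetric]) auto
  finally show ?thesis by (rule power2_le_imp_le) simp
qed

text \<open>Riesz-Fischer: a subsequence with geometrically small steps converges almost everywhere,
  and Fatou's lemma turns the pointwise limit into a limit in norm for the whole sequence.\<close>

lemma L2_complete:
  assumes a: "\<And>n. a n \<in> square_integrable_set M"
    and cauchy: "\<And>e. e > 0 \<Longrightarrow> \<exists>N. \<forall>m\<ge>N. \<forall>n\<ge>N. L2_norm M (\<lambda>x. a m x - a n x) < e"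
  obtains h where "h \<in> square_integrable_set M" "(\<lambda>n. L2_norm M (\<lambda>x. a n x - h x)) \<longlonglongrightarrow> 0"
proof -
  have [measurable]: "a n \<in> borel_measurable M" for n
    using a[of n] by (simp add: square_integrable_set_def)
  \<comment> \<open>The rate 1/4 leaves room for weights: squared norms are at most
    \<open>(1/16)^k\<close>, so after multiplication by \<open>4^k\<close> the convergent series of
    \<open>(1/4)^k\<close> remains.\<close>
  have "\<forall>k. \<exists>N. \<forall>m\<ge>N. \<forall>n\<ge>N. L2_norm M (\<lambda>x. a m x - a n x) < (1/4)^k"
    by (intro allI cauchy) simp
  then obtain N where N: "\<And>k m n. N k \<le> m \<Longrightarrow> N k \<le> n \<Longrightarrow> L2_norm M (\<lambda>x. a m x - a n x) < (1/4)^k"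
    by metis
  \<comment> \<open>Adding all earlier thresholds puts both \<open>r k\<close> and
    \<open>r (Suc k)\<close> beyond \<open>N k\<close>; the summand \<open>k\<close> makes
    \<open>r\<close> tend to infinity.\<close>
  define r where "r k = k + (\<Sum>i\<le>k. N i)" for k
  have rk: "k \<le> r k" "N k \<le> r k" "N k \<le> r (Suc k)" for k
    using member_le_sum[of k "{..k}" N] by (auto simp: r_def)
  define d where "d k x = a (r (Suc k)) x - a (r k) x" for k x
  have d_SQ: "d k \<in> square_integrable_set M" for k
    unfolding d_def by (intro square_integrable_diff a)
  have [measurable]: "d k \<in> borel_measurable M" for k
    unfolding d_def by measurable
  have d_norm: "L2_norm M (d k) \<le> (1/4)^k" for k
    unfolding d_def by (intro less_imp_le N rk)
  \<comment> \<open>The weights \<open>4^k\<close> force \<open>\<bar>d k x\<bar> \<le> (1/2)^k\<close> for large \<open>k\<close>, for almost every \<open>x\<close>.\<close>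
  have "(\<integral>\<^sup>+x. (\<Sum>k. ennreal (4^k * (cmod (d k x))\<^sup>2)) \<partial>M)
      = (\<Sum>k. \<integral>\<^sup>+x. ennreal (4^k * (cmod (d k x))\<^sup>2) \<partial>M)"
    by (rule nn_integral_suminf) measurable
  also have "\<dots> \<le> (\<Sum>k. ennreal ((1/4)^k))"
  proof (intro suminf_le summableI)
    fix k
    have "(\<integral>\<^sup>+x. ennreal (4^k * (cmod (d k x))\<^sup>2) \<partial>M)
        = ennreal (4^k) * (\<integral>\<^sup>+x. ennreal ((cmod (d k x))\<^sup>2) \<partial>M)"
      by (subst nn_integral_cmult[symmetric]) (auto simp: ennreal_mult')
    also have "\<dots> = ennreal (4^k * (L2_norm M (d k))\<^sup>2)"
      by (simp add: L2_norm_power2_nn[OF d_SQ] ennreal_mult')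
    also have "\<dots> \<le> ennreal (4^k * ((1/4)^k)\<^sup>2)"
      by (intro ennreal_leI mult_left_mono power_mono d_norm) auto
    also have "4^k * ((1/4)^k)\<^sup>2 = (1/4::real)^k"
      by (simp add: power2_eq_square power_divide field_simps)
    finally show "(\<integral>\<^sup>+x. ennreal (4^k * (cmod (d k x))\<^sup>2) \<partial>M) \<le> ennreal ((1/4)^k)" .
  qed
  also have "\<dots> = ennreal (\<Sum>k. (1/4)^k)"
    by (rule suminf_ennreal2) (auto intro: summable_geometric)
  finally have "(\<integral>\<^sup>+x. (\<Sum>k. ennreal (4^k * (cmod (d k x))\<^sup>2)) \<partial>M) \<noteq> \<infinity>"
    by (auto simp: top_unique)
  then have "AE x in M. (\<Sum>k. ennreal (4^k * (cmod (d k x))\<^sup>2)) \<noteq> \<infinity>"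
    by (intro nn_integral_noteq_infinite) auto
  then have AE_conv: "AE x in M. convergent (\<lambda>k. a (r k) x)"
  proof (rule AE_mp, intro AE_I2 impI)
    fix x assume "(\<Sum>k. ennreal (4^k * (cmod (d k x))\<^sup>2)) \<noteq> \<infinity>"
    then have "summable (\<lambda>k. 4^k * (cmod (d k x))\<^sup>2)"
      by (intro summable_suminf_not_top) auto
    then have "(\<lambda>k. 4^k * (cmod (d k x))\<^sup>2) \<longlonglongrightarrow> 0"
      by (rule summable_LIMSEQ_zero)
    then have ev: "\<forall>\<^sub>F k in sequentially. 4^k * (cmod (d k x))\<^sup>2 < 1"
      by (rule order_tendstoD) simp
    have "summable (\<lambda>k. d k x)"
    proof (rule summable_comparison_test_ev)
      show "\<forall>\<^sub>F k in sequentially. norm (d k x) \<le> (1/2)^k"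
        using ev
      proof eventually_elim
        case (elim k)
        have "(2^k * cmod (d k x))\<^sup>2 = 4^k * (cmod (d k x))\<^sup>2"
          by (simp add: power_mult_distrib power_even_eq[symmetric] flip: power_mult)
            (simp add: power_mult mult.commute[of k])
        with elim have "(2^k * cmod (d k x))\<^sup>2 \<le> 1\<^sup>2" by simp
        then have "2^k * cmod (d k x) \<le> 1" by (rule power2_le_imp_le) simp
        then show ?case by (simp add: field_simps power_divide)
      qed
    qed (auto intro: summable_geometric)
    then have "convergent (\<lambda>n. \<Sum>k<n. d k x)"
      by (simp add: summable_iff_convergent)
    then have "convergent (\<lambda>n. a (r n) x - a (r 0) x)"
      using sum_lessThan_telescope[of "\<lambda>k. a (r k) x"] by (simp add: d_def)
    from convergent_add[OF this convergent_const[of "a (r 0) x"]]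
    show "convergent (\<lambda>k. a (r k) x)" by simp
  qed
  \<comment> \<open>Where the subsequence diverges, \<open>lim\<close> returns one fixed unspecified
    value, so \<open>h\<close> is measurable everywhere; this happens only on a null set.\<close>
  define h where "h x = lim (\<lambda>k. a (r k) x)" for x
  have [measurable]: "h \<in> borel_measurable M"
    unfolding h_def by (rule borel_measurable_lim_metric) measurable
  \<comment> \<open>Fatou's lemma with \<open>m\<close> fixed while \<open>k\<close> grows.
    Integrability of \<open>a m - h\<close> comes out together with the bound; \<open>h\<close>
    itself is not yet known to be square integrable.\<close>
  have tail: "(\<lambda>x. a m x - h x) \<in> square_integrable_set M \<and> L2_norm M (\<lambda>x. a m x - h x) \<le> e"
    if e: "e \<ge> 0" and K: "\<And>n. n \<ge> K \<Longrightarrow> L2_norm M (\<lambda>x. a m x - a n x) \<le> e" for m K e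
  proof -
    have "(\<integral>\<^sup>+x. ennreal ((cmod (a m x - h x))\<^sup>2) \<partial>M)
        = (\<integral>\<^sup>+x. liminf (\<lambda>k. ennreal ((cmod (a m x - a (r k) x))\<^sup>2)) \<partial>M)"
    proof (rule nn_integral_cong_AE, use AE_conv in eventually_elim)
      case (elim x)
      then have "(\<lambda>k. a (r k) x) \<longlonglongrightarrow> h x" by (simp add: h_def convergent_LIMSEQ_iff)
      then have "(\<lambda>k. ennreal ((cmod (a m x - a (r k) x))\<^sup>2)) \<longlonglongrightarrow> ennreal ((cmod (a m x - h x))\<^sup>2)"
        by (intro tendsto_intros)
      then show ?case by (intro lim_imp_Liminf[symmetric] trivial_limit_sequentially)
    qed
    also have "\<dots> \<le> liminf (\<lambda>k. \<integral>\<^sup>+x. ennreal ((cmod (a m x - a (r k) x))\<^sup>2) \<partial>M)"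
      by (rule nn_integral_liminf) measurable
    also have "\<dots> \<le> limsup (\<lambda>k. \<integral>\<^sup>+x. ennreal ((cmod (a m x - a (r k) x))\<^sup>2) \<partial>M)"
      by (rule Liminf_le_Limsup) simp
    also have "\<dots> \<le> ennreal (e\<^sup>2)"
    proof (rule Limsup_bounded, rule eventually_sequentiallyI)
      fix k assume "k \<ge> K"
      with rk(1)[of k] have "L2_norm M (\<lambda>x. a m x - a (r k) x) \<le> e" by (intro K) simp
      then show "(\<integral>\<^sup>+x. ennreal ((cmod (a m x - a (r k) x))\<^sup>2) \<partial>M) \<le> ennreal (e\<^sup>2)"
        by (subst L2_norm_power2_nn[OF square_integrable_diff[OF a a]])
          (intro ennreal_leI power_mono, auto)
    qed
    finally show ?thesis
      using square_integrable_nnI[of "\<lambda>x. a m x - h x" M e] e by simp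
  qed
  obtain K where "\<forall>m\<ge>K. \<forall>n\<ge>K. L2_norm M (\<lambda>x. a m x - a n x) < 1" using cauchy[of 1] by auto
  then have "(\<lambda>x. a K x - h x) \<in> square_integrable_set M"
    using tail[of 1 K K] by (auto simp: less_imp_le)
  \<comment> \<open>One index suffices, since \<open>h\<close> is \<open>a K\<close> minus
    \<open>a K - h\<close>.\<close>
  then have h: "h \<in> square_integrable_set M"
    using square_integrable_diff[OF a[of K]] by fastforce
  have "(\<lambda>n. L2_norm M (\<lambda>x. a n x - h x)) \<longlonglongrightarrow> 0"
  proof (rule LIMSEQ_I)
    fix e :: real assume "e > 0"
    then obtain K where K: "\<And>m n. K \<le> m \<Longrightarrow> K \<le> n \<Longrightarrow> L2_norm M (\<lambda>x. a m x - a n x) < e/2"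
      using cauchy[of "e/2"] by auto
    have "norm (L2_norm M (\<lambda>x. a m x - h x) - 0) < e" if "m \<ge> K" for m
      using tail[of "e/2" K m] K[OF that] \<open>e > 0\<close> by (auto simp: less_imp_le)
    then show "\<exists>K. \<forall>m\<ge>K. norm (L2_norm M (\<lambda>x. a m x - h x) - 0) < e" by blast
  qed
  with h show thesis by (rule that)
qed

section \<open>Closed subspaces and orthogonal sums\<close>

lemma L2_closure_subset: "L2_closure M S \<subseteq> square_integrable_set M"
  by (auto simp: L2_closure_def)

lemma L2_closureI:
  assumes "f \<in> square_integrable_set M"
    and "\<And>e. e > 0 \<Longrightarrow> \<exists>g \<in> S \<inter> square_integrable_set M. L2_norm M (\<lambda>x. f x - g x) < e"
  shows "f \<in> L2_closure M S"
  using assms by (simp add: L2_closure_def)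

lemma L2_closureE:
  assumes "f \<in> L2_closure M S" "e > 0"
  obtains g where "g \<in> S" "g \<in> square_integrable_set M" "L2_norm M (\<lambda>x. f x - g x) < e"
  using assms by (auto simp: L2_closure_def)

lemma subset_L2_closure: "S \<inter> square_integrable_set M \<subseteq> L2_closure M S"
  by (auto simp: L2_closure_def intro!: bexI)

lemma L2_closure_closure [simp]: "L2_closure M (L2_closure M S) = L2_closure M S"
proof
  show "L2_closure M (L2_closure M S) \<subseteq> L2_closure M S"
  proof
    fix f assume f: "f \<in> L2_closure M (L2_closure M S)"
    then have fS: "f \<in> square_integrable_set M" using L2_closure_subset by blast
    then show "f \<in> L2_closure M S"
    proof (rule L2_closureI)
      fix e :: real assume "e > 0"
      then have "e/2 > 0" by simp
      from f this obtain g where g: "g \<in> L2_closure M S" "g \<in> square_integrable_set M" "L2_norm M (\<lambda>x. f x - g x) < e/2"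
        by (rule L2_closureE)
      from g(1) \<open>e/2 > 0\<close> obtain k where k: "k \<in> S" "k \<in> square_integrable_set M" "L2_norm M (\<lambda>x. g x - k x) < e/2"
        by (rule L2_closureE)
      have "L2_norm M (\<lambda>x. f x - k x) < e"
        using L2_norm_triangle_diff[OF fS g(2) k(2)] g(3) k(3) by simp
      with k show "\<exists>g \<in> S \<inter> square_integrable_set M. L2_norm M (\<lambda>x. f x - g x) < e" by blast
    qed
  qed
next
  have "L2_closure M S \<inter> square_integrable_set M = L2_closure M S" using L2_closure_subset by blast
  then show "L2_closure M S \<subseteq> L2_closure M (L2_closure M S)"
    using subset_L2_closure[of "L2_closure M S" M] by simp
qed

lemma L2_closure_add:
  assumes S: "\<And>f g. f \<in> S \<Longrightarrow> g \<in> S \<Longrightarrow> (\<lambda>x. f x + g x) \<in> S"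
    and f: "f \<in> L2_closure M S" and g: "g \<in> L2_closure M S"
  shows "(\<lambda>x. f x + g x) \<in> L2_closure M S"
proof (rule L2_closureI)
  have SQ: "f \<in> square_integrable_set M" "g \<in> square_integrable_set M"
    using f g L2_closure_subset by blast+
  then show "(\<lambda>x. f x + g x) \<in> square_integrable_set M" by (rule square_integrable_add)
  fix e :: real assume "e > 0"
  then have "e/2 > 0" by simp
  obtain u where u: "u \<in> S" "u \<in> square_integrable_set M" "L2_norm M (\<lambda>x. f x - u x) < e/2"
    using f \<open>e/2 > 0\<close> by (rule L2_closureE)
  obtain v where v: "v \<in> S" "v \<in> square_integrable_set M" "L2_norm M (\<lambda>x. g x - v x) < e/2"
    using g \<open>e/2 > 0\<close> by (rule L2_closureE)
  have "L2_norm M (\<lambda>x. f x + g x - (u x + v x)) \<le> L2_norm M (\<lambda>x. f x - u x) + L2_norm M (\<lambda>x. g x - v x)"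
    using L2_norm_triangle[OF square_integrable_diff[OF SQ(1) u(2)] square_integrable_diff[OF SQ(2) v(2)]]
    by (simp add: algebra_simps)
  with u v have "L2_norm M (\<lambda>x. f x + g x - (u x + v x)) < e" by simp
  then show "\<exists>k \<in> S \<inter> square_integrable_set M. L2_norm M (\<lambda>x. f x + g x - k x) < e"
    using S[OF u(1) v(1)] square_integrable_add[OF u(2) v(2)] by (intro bexI) auto
qed

lemma L2_closure_cmult:
  assumes S: "\<And>f. f \<in> S \<Longrightarrow> (\<lambda>x. c * f x) \<in> S"
    and f: "f \<in> L2_closure M S"
  shows "(\<lambda>x. c * f x) \<in> L2_closure M S"
proof (rule L2_closureI)
  show "(\<lambda>x. c * f x) \<in> square_integrable_set M"
    using f L2_closure_subset by (blast intro: square_integrable_cmult)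
  fix e :: real assume "e > 0"
  \<comment> \<open>The summand 1 keeps the denominator positive when \<open>c = 0\<close>.\<close>
  then have "e / (cmod c + 1) > 0" by (simp add: add_nonneg_pos)
  with f obtain u where u: "u \<in> S" "u \<in> square_integrable_set M" "L2_norm M (\<lambda>x. f x - u x) < e / (cmod c + 1)"
    by (rule L2_closureE)
  have "L2_norm M (\<lambda>x. c * f x - c * u x) = cmod c * L2_norm M (\<lambda>x. f x - u x)"
    by (subst L2_norm_cmult[symmetric]) (simp add: algebra_simps)
  also have "\<dots> \<le> (cmod c + 1) * L2_norm M (\<lambda>x. f x - u x)" by (intro mult_right_mono) auto
  also have "\<dots> < e" using u(3) norm_ge_zero[of c] by (simp add: field_simps add_nonneg_pos)
  finally show "\<exists>k \<in> S \<inter> square_integrable_set M. L2_norm M (\<lambda>x. c * f x - k x) < e"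
    using S[OF u(1)] square_integrable_cmult[OF u(2)] by (intro bexI) auto
qed

lemma L2_closed_subspace_closure:
  assumes "(\<lambda>x. 0) \<in> S"
    and "\<And>f g. f \<in> S \<Longrightarrow> g \<in> S \<Longrightarrow> (\<lambda>x. f x + g x) \<in> S"
    and "\<And>c f. f \<in> S \<Longrightarrow> (\<lambda>x. c * f x) \<in> S"
  shows "L2_closed_subspace M (L2_closure M S)"
  unfolding L2_closed_subspace_def
proof (intro conjI ballI allI)
  show "(\<lambda>x. 0) \<in> L2_closure M S"
    using assms(1) subset_L2_closure[of S M] square_integrable_zero by blast
qed (simp_all add: L2_closure_subset L2_closure_add L2_closure_cmult assms)

text \<open>Continuity of the inner product: replacing \<open>f\<close> by a nearby \<open>s\<close>
  changes the value by at most the distance times the norm of \<open>g\<close>, by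
  Cauchy-Schwarz.\<close>

lemma L2_inner_closure_eq_0:
  assumes f: "f \<in> L2_closure M S" and g: "g \<in> square_integrable_set M"
    and orth: "\<And>s. s \<in> S \<Longrightarrow> s \<in> square_integrable_set M \<Longrightarrow> L2_inner M s g = 0"
  shows "L2_inner M f g = 0"
proof -
  have fS: "f \<in> square_integrable_set M" using f L2_closure_subset by blast
  have "cmod (L2_inner M f g) \<le> e" if "e > 0" for e
  proof -
    have "e / (L2_norm M g + 1) > 0" using that by (simp add: add_nonneg_pos)
    with f obtain s where s: "s \<in> S" "s \<in> square_integrable_set M"
        "L2_norm M (\<lambda>x. f x - s x) < e / (L2_norm M g + 1)"
      by (rule L2_closureE)
    have "L2_inner M f g = L2_inner M (\<lambda>x. f x - s x) g"
      using L2_inner_add_left[OF square_integrable_diff[OF fS s(2)] s(2) g] orth[OF s(1,2)] by simp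
    also have "cmod \<dots> \<le> L2_norm M (\<lambda>x. f x - s x) * L2_norm M g"
      by (intro L2_Cauchy_Schwarz square_integrable_diff fS s g)
    also have "\<dots> \<le> L2_norm M (\<lambda>x. f x - s x) * (L2_norm M g + 1)"
      by (intro mult_left_mono) auto
    also have "\<dots> \<le> e"
      using s(3) by (simp add: pos_less_divide_eq add_nonneg_pos less_imp_le)
    finally show ?thesis .
  qed
  then have "cmod (L2_inner M f g) \<le> 0" by (rule field_le_epsilon[where y=0, simplified])
  then show ?thesis by simp
qed

lemma L2_inner_closures_eq_0:
  assumes "f \<in> L2_closure M S" "g \<in> L2_closure M T"
    and orth: "\<And>s t. s \<in> S \<Longrightarrow> t \<in> T \<Longrightarrow> s \<in> square_integrable_set M \<Longrightarrow>
        t \<in> square_integrable_set M \<Longrightarrow> L2_inner M s t = 0"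
  shows "L2_inner M f g = 0"
proof -
  have "L2_inner M s g = 0" if s: "s \<in> S" "s \<in> square_integrable_set M" for s
  proof -
    have "L2_inner M g s = 0"
      using assms(2) s(2)
    proof (rule L2_inner_closure_eq_0)
      show "L2_inner M t s = 0" if "t \<in> T" "t \<in> square_integrable_set M" for t
        using orth[OF s(1) that(1) s(2) that(2)] by (subst L2_inner_commute) simp
    qed
    then show ?thesis by (subst L2_inner_commute) simp
  qed
  with assms show ?thesis
    using L2_closure_subset by (intro L2_inner_closure_eq_0[OF assms(1)]) blast+
qed

text \<open>Reduces the expansion of every \<open>f\<close> to approximation by finite sums. The
  components of successive approximants form a Cauchy sequence in each \<open>V i\<close>, with a
  rate common to all finite index sets; hence the limits of the components sum to \<open>f\<close>
  along the whole net and not just along one sequence of sets.\<close>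

lemma L2_orthogonal_sumI_dense:
  assumes closed: "\<And>i. i \<in> I \<Longrightarrow> L2_closed_subspace M (V i)"
    and orth: "\<And>i j f g. i \<in> I \<Longrightarrow> j \<in> I \<Longrightarrow> i \<noteq> j \<Longrightarrow> f \<in> V i \<Longrightarrow> g \<in> V j \<Longrightarrow> L2_inner M f g = 0"
    and dense: "\<And>f e. f \<in> square_integrable_set M \<Longrightarrow> e > 0 \<Longrightarrow>
      \<exists>F u. finite F \<and> F \<subseteq> I \<and> (\<forall>i\<in>F. u i \<in> V i) \<and> L2_norm M (\<lambda>x. f x - (\<Sum>i\<in>F. u i x)) < e"
  shows "L2_orthogonal_sum M I V"
proof -
  have V_SQ: "g \<in> square_integrable_set M" if "i \<in> I" "g \<in> V i" for i g
    using closed[OF that(1)] that(2) by (auto simp: L2_closed_subspace_def)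
  have V_zero: "(\<lambda>x. 0) \<in> V i" if "i \<in> I" for i
    using closed[OF that] by (simp add: L2_closed_subspace_def)
  have V_closure: "L2_closure M (V i) = V i" if "i \<in> I" for i
    using closed[OF that] by (simp add: L2_closed_subspace_def)
  have V_cmult: "(\<lambda>x. c * g x) \<in> V i" if "i \<in> I" "g \<in> V i" for i g c
    using closed[OF that(1)] that(2) by (simp add: L2_closed_subspace_def)
  have V_add: "(\<lambda>x. g x + g' x) \<in> V i" if "i \<in> I" "g \<in> V i" "g' \<in> V i" for i g g'
    using closed[OF that(1)] that(2,3) by (simp add: L2_closed_subspace_def)
  have V_diff: "(\<lambda>x. g x - g' x) \<in> V i" if "i \<in> I" "g \<in> V i" "g' \<in> V i" for i g g'
    using V_add[OF that(1,2) V_cmult[OF that(1,3), of "-1"]] by simp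
  have mono: "L2_norm M (\<lambda>x. \<Sum>i\<in>F. u i x) \<le> L2_norm M (\<lambda>x. \<Sum>i\<in>G. u i x)"
    if "finite G" "F \<subseteq> G" "G \<subseteq> I" "\<And>i. i \<in> I \<Longrightarrow> u i \<in> V i" for F G u
    using that(1,2)
  proof (rule L2_norm_orthogonal_sum_mono)
    have I: "i \<in> I" if "i \<in> G" for i using that \<open>G \<subseteq> I\<close> by blast
    show "u i \<in> square_integrable_set M" if "i \<in> G" for i
      by (rule V_SQ[OF I[OF that] \<open>\<And>i. i \<in> I \<Longrightarrow> u i \<in> V i\<close>[OF I[OF that]]])
    show "L2_inner M (u i) (u j) = 0" if "i \<in> G" "j \<in> G" "i \<noteq> j" for i j
      using that by (intro orth[of i j] I \<open>\<And>i. i \<in> I \<Longrightarrow> u i \<in> V i\<close>)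
  qed
  have "\<exists>h. (\<forall>i\<in>I. h i \<in> V i) \<and>
      ((\<lambda>F. L2_norm M (\<lambda>x. f x - (\<Sum>i\<in>F. h i x))) \<longlongrightarrow> 0) (finite_subsets_at_top I)"
    if f: "f \<in> square_integrable_set M" for f
  proof -
    define \<epsilon> :: "nat \<Rightarrow> real" where "\<epsilon> n = 1 / real (Suc n)" for n
    have \<epsilon>0: "\<epsilon> \<longlonglongrightarrow> 0"
      unfolding \<epsilon>_def using LIMSEQ_inverse_real_of_nat by (simp add: inverse_eq_divide)
    have "\<forall>n. \<exists>F u. finite F \<and> F \<subseteq> I \<and> (\<forall>i\<in>F. u i \<in> V i) \<and>
        L2_norm M (\<lambda>x. f x - (\<Sum>i\<in>F. u i x)) < \<epsilon> n"
      by (intro allI dense f) (simp add: \<epsilon>_def)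
    then obtain F u' where Fu: "\<And>n. finite (F n)" "\<And>n. F n \<subseteq> I" "\<And>n i. i \<in> F n \<Longrightarrow> u' n i \<in> V i"
        "\<And>n. L2_norm M (\<lambda>x. f x - (\<Sum>i\<in>F n. u' n i x)) < \<epsilon> n"
      by metis
    \<comment> \<open>Padding with zero lets the \<open>n\<close>-th approximant be summed over any
      finite set containing \<open>F n\<close> without changing it, so approximants with different
      index sets become comparable.\<close>
    define u where "u n i = (if i \<in> F n then u' n i else (\<lambda>x. 0))" for n i
    have uV: "u n i \<in> V i" if "i \<in> I" for n i
      using Fu(3)[of i n] V_zero[OF that] by (auto simp: u_def)
    have sum_u: "(\<Sum>i\<in>G. u n i x) = (\<Sum>i\<in>F n. u' n i x)" if "finite G" "F n \<subseteq> G" for G n x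
      using that by (intro sum.mono_neutral_cong_right) (auto simp: u_def)
    have approx: "L2_norm M (\<lambda>x. f x - (\<Sum>i\<in>G. u n i x)) < \<epsilon> n" if "finite G" "F n \<subseteq> G" for G n
      using Fu(4)[of n] by (simp add: sum_u[OF that])
    have sum_SQ: "(\<lambda>x. \<Sum>i\<in>G. w i x) \<in> square_integrable_set M"
      if "G \<subseteq> I" "\<And>i. i \<in> I \<Longrightarrow> w i \<in> V i" for G w
      using that by (intro square_integrable_sum V_SQ[OF _ that(2)]) auto
    have diff: "L2_norm M (\<lambda>x. \<Sum>i\<in>G. u m i x - u n i x) \<le> \<epsilon> m + \<epsilon> n"
      if G: "finite G" "G \<subseteq> I" for G m n
    proof -
      \<comment> \<open>On \<open>H\<close> both approximants are complete, so each is close to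
        \<open>f\<close>; enlarging \<open>G\<close> to \<open>H\<close> costs nothing by
        \<open>mono\<close>. The resulting bound does not depend on \<open>G\<close>.\<close>
      define H where "H = G \<union> F m \<union> F n"
      have H: "finite H" "H \<subseteq> I" "G \<subseteq> H" "F m \<subseteq> H" "F n \<subseteq> H"
        using G Fu by (auto simp: H_def)
      have "L2_norm M (\<lambda>x. \<Sum>i\<in>G. u m i x - u n i x) \<le> L2_norm M (\<lambda>x. \<Sum>i\<in>H. u m i x - u n i x)"
        by (rule mono) (auto intro!: H V_diff uV)
      also have "\<dots> = L2_norm M (\<lambda>x. (\<Sum>i\<in>H. u m i x) - (\<Sum>i\<in>H. u n i x))"
        by (simp add: sum_subtractf)
      also have "\<dots> \<le> L2_norm M (\<lambda>x. (\<Sum>i\<in>H. u m i x) - f x) + L2_norm M (\<lambda>x. f x - (\<Sum>i\<in>H. u n i x))"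
        by (intro L2_norm_triangle_diff f sum_SQ H uV)
      also have "\<dots> \<le> \<epsilon> m + \<epsilon> n"
        using approx[OF H(1,4)] approx[OF H(1,5)] by (simp add: L2_norm_minus_commute)
      finally show ?thesis .
    qed
    have "\<exists>h. h \<in> V i \<and> (\<lambda>n. L2_norm M (\<lambda>x. u n i x - h x)) \<longlonglongrightarrow> 0" if i: "i \<in> I" for i
    proof -
      have "\<exists>N. \<forall>m\<ge>N. \<forall>n\<ge>N. L2_norm M (\<lambda>x. u m i x - u n i x) < e" if "e > 0" for e
      proof -
        have "\<forall>\<^sub>F n in sequentially. \<epsilon> n < e/2"
          using \<epsilon>0 by (rule order_tendstoD) (use that in simp)
        then obtain N where N: "\<And>n. n \<ge> N \<Longrightarrow> \<epsilon> n < e/2" by (auto simp: eventually_sequentially)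
        have "L2_norm M (\<lambda>x. u m i x - u n i x) < e" if "m \<ge> N" "n \<ge> N" for m n
          using diff[of "{i}" m n] N[OF that(1)] N[OF that(2)] i by simp
        then show ?thesis by blast
      qed
      then obtain h where h: "h \<in> square_integrable_set M" "(\<lambda>n. L2_norm M (\<lambda>x. u n i x - h x)) \<longlonglongrightarrow> 0"
        using L2_complete[of "\<lambda>n. u n i" M] V_SQ[OF i uV[OF i]] by blast
      have "h \<in> L2_closure M (V i)"
        using h(1)
      proof (rule L2_closureI)
        fix e :: real assume "e > 0"
        with h(2) have "\<forall>\<^sub>F n in sequentially. L2_norm M (\<lambda>x. u n i x - h x) < e"
          by (intro order_tendstoD) auto
        then obtain n where "L2_norm M (\<lambda>x. u n i x - h x) < e"
          by (auto simp: eventually_sequentially)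
        then show "\<exists>g\<in>V i \<inter> square_integrable_set M. L2_norm M (\<lambda>x. h x - g x) < e"
          using uV[OF i] V_SQ[OF i uV[OF i]] by (intro bexI[of _ "u n i"]) (auto simp: L2_norm_minus_commute)
      qed
      then have "h \<in> V i" by (simp add: V_closure i)
      with h show ?thesis by blast
    qed
    then obtain h where hV: "\<And>i. i \<in> I \<Longrightarrow> h i \<in> V i"
        and h: "\<And>i. i \<in> I \<Longrightarrow> (\<lambda>n. L2_norm M (\<lambda>x. u n i x - h i x)) \<longlonglongrightarrow> 0"
      by metis
    \<comment> \<open>One \<open>\<epsilon> n\<close> is the distance from \<open>f\<close> to its
      \<open>n\<close>-th approximant, the other the distance from that approximant to the limit
      components. Every finite \<open>G\<close> above \<open>F n\<close> is covered, as convergence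
      along \<open>finite_subsets_at_top\<close> demands.\<close>
    have limit: "L2_norm M (\<lambda>x. f x - (\<Sum>i\<in>G. h i x)) \<le> 2 * \<epsilon> n"
      if G: "finite G" "G \<subseteq> I" "F n \<subseteq> G" for G n
    proof -
      \<comment> \<open>Insert \<open>u m\<close> between \<open>u n\<close> and \<open>h\<close>
        and let \<open>m\<close> grow: \<open>diff\<close> contributes
        \<open>\<epsilon> n + \<epsilon> m\<close>, and for the fixed finite \<open>G\<close> the
        sum of the componentwise errors vanishes.\<close>
      have "L2_norm M (\<lambda>x. (\<Sum>i\<in>G. u n i x) - (\<Sum>i\<in>G. h i x)) \<le> \<epsilon> n"
      proof (rule LIMSEQ_le_const)
        have "(\<lambda>m. \<epsilon> n + \<epsilon> m + (\<Sum>i\<in>G. L2_norm M (\<lambda>x. u m i x - h i x))) \<longlonglongrightarrow> \<epsilon> n + 0 + (\<Sum>i\<in>G. 0)"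
          using G by (intro tendsto_intros \<epsilon>0 h) auto
        then show "(\<lambda>m. \<epsilon> n + \<epsilon> m + (\<Sum>i\<in>G. L2_norm M (\<lambda>x. u m i x - h i x))) \<longlonglongrightarrow> \<epsilon> n"
          by simp
        have "L2_norm M (\<lambda>x. (\<Sum>i\<in>G. u n i x) - (\<Sum>i\<in>G. h i x))
            \<le> \<epsilon> n + \<epsilon> m + (\<Sum>i\<in>G. L2_norm M (\<lambda>x. u m i x - h i x))" for m
        proof -
          have "L2_norm M (\<lambda>x. (\<Sum>i\<in>G. u n i x) - (\<Sum>i\<in>G. h i x))
              \<le> L2_norm M (\<lambda>x. (\<Sum>i\<in>G. u n i x) - (\<Sum>i\<in>G. u m i x))
                + L2_norm M (\<lambda>x. (\<Sum>i\<in>G. u m i x) - (\<Sum>i\<in>G. h i x))"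
            by (intro L2_norm_triangle_diff sum_SQ G uV hV)
          also have "\<dots> \<le> (\<epsilon> n + \<epsilon> m) + (\<Sum>i\<in>G. L2_norm M (\<lambda>x. u m i x - h i x))"
          proof (rule add_mono)
            show "L2_norm M (\<lambda>x. (\<Sum>i\<in>G. u n i x) - (\<Sum>i\<in>G. u m i x)) \<le> \<epsilon> n + \<epsilon> m"
              using diff[OF G(1,2), of n m] by (simp add: sum_subtractf)
            show "L2_norm M (\<lambda>x. (\<Sum>i\<in>G. u m i x) - (\<Sum>i\<in>G. h i x))
                \<le> (\<Sum>i\<in>G. L2_norm M (\<lambda>x. u m i x - h i x))"
              unfolding sum_subtractf[symmetric]
              using G(2) by (intro L2_norm_sum_le square_integrable_diff) (auto intro: V_SQ uV hV)
          qed
          finally show ?thesis .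
        qed
        then show "\<exists>N. \<forall>m\<ge>N. L2_norm M (\<lambda>x. (\<Sum>i\<in>G. u n i x) - (\<Sum>i\<in>G. h i x))
            \<le> \<epsilon> n + \<epsilon> m + (\<Sum>i\<in>G. L2_norm M (\<lambda>x. u m i x - h i x))" by blast
      qed
      moreover have "L2_norm M (\<lambda>x. f x - (\<Sum>i\<in>G. h i x))
          \<le> L2_norm M (\<lambda>x. f x - (\<Sum>i\<in>G. u n i x))
            + L2_norm M (\<lambda>x. (\<Sum>i\<in>G. u n i x) - (\<Sum>i\<in>G. h i x))"
        by (intro L2_norm_triangle_diff sum_SQ f G uV hV)
      ultimately show ?thesis using approx[OF G(1,3)] by simp
    qed
    have "((\<lambda>F. L2_norm M (\<lambda>x. f x - (\<Sum>i\<in>F. h i x))) \<longlongrightarrow> 0) (finite_subsets_at_top I)"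
    proof (rule tendstoI)
      fix e :: real assume "e > 0"
      have "\<forall>\<^sub>F n in sequentially. \<epsilon> n < e/2"
        using \<epsilon>0 by (rule order_tendstoD) (use \<open>e > 0\<close> in simp)
      then obtain n where n: "\<epsilon> n < e/2" by (auto simp: eventually_sequentially)
      show "\<forall>\<^sub>F G in finite_subsets_at_top I. dist (L2_norm M (\<lambda>x. f x - (\<Sum>i\<in>G. h i x))) 0 < e"
        unfolding eventually_finite_subsets_at_top
      proof (intro exI conjI allI impI)
        show "finite (F n)" "F n \<subseteq> I" by (rule Fu)+
        fix G assume "finite G \<and> F n \<subseteq> G \<and> G \<subseteq> I"
        then show "dist (L2_norm M (\<lambda>x. f x - (\<Sum>i\<in>G. h i x))) 0 < e"
          using limit[of G n] n by simp
      qed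
    qed
    with hV show ?thesis by blast
  qed
  then show ?thesis
    unfolding L2_orthogonal_sum_def by (intro conjI ballI impI) (simp_all add: closed orth)
qed

section \<open>Linear spans of functions\<close>

lemma fun_span_zero [simp]: "(\<lambda>x. 0) \<in> fun_span S"
  unfolding fun_span_def by (rule CollectI) (rule exI[of _ "{}"], simp)

lemma fun_span_base: "f \<in> S \<Longrightarrow> f \<in> fun_span S"
  unfolding fun_span_def by (rule CollectI) (rule exI[of _ "{f}"], rule exI[of _ "\<lambda>_. 1"], simp)

lemma fun_span_cmult: 
  assumes "f \<in> fun_span S"
  shows "(\<lambda>x. c * f x) \<in> fun_span S"
proof -
  from assms obtain F d where "finite F" "F \<subseteq> S" "f = (\<lambda>x. \<Sum>g\<in>F. d g * g x)"
    by (auto simp: fun_span_def)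
  then show ?thesis
    unfolding fun_span_def
    by (intro CollectI exI[of _ F] exI[of _ "\<lambda>g. c * d g"]) (simp add: sum_distrib_left mult.assoc)
qed

lemma fun_span_add: 
  assumes "f \<in> fun_span S" "g \<in> fun_span S"
  shows "(\<lambda>x. f x + g x) \<in> fun_span S"
proof -
  from assms obtain F c G d where *: "finite F" "F \<subseteq> S" "f = (\<lambda>x. \<Sum>k\<in>F. c k * k x)"
      "finite G" "G \<subseteq> S" "g = (\<lambda>x. \<Sum>k\<in>G. d k * k x)"
    by (auto simp: fun_span_def)
  \<comment> \<open>Both coefficient families are extended by zero to \<open>F \<union> G\<close>,
    so a function occurring in both sets receives the sum of its coefficients.\<close>
  let ?e = "\<lambda>k. (if k \<in> F then c k else 0) + (if k \<in> G then d k else 0)"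
  have "(\<Sum>k\<in>F. c k * k x) = (\<Sum>k\<in>F \<union> G. (if k \<in> F then c k else 0) * k x)"
       "(\<Sum>k\<in>G. d k * k x) = (\<Sum>k\<in>F \<union> G. (if k \<in> G then d k else 0) * k x)" for x
    using * by (intro sum.mono_neutral_cong_left; auto)+
  then have "(\<lambda>x. f x + g x) = (\<lambda>x. \<Sum>k\<in>F \<union> G. ?e k * k x)"
    by (simp add: * distrib_right sum.distrib)
  with * show ?thesis
    unfolding fun_span_def by (intro CollectI exI[of _ "F \<union> G"] exI[of _ ?e]) auto
qed

lemma fun_span_induct [consumes 1, case_names zero add]:
  assumes "f \<in> fun_span S" and zero: "P (\<lambda>x. 0)"
    and add: "\<And>c g h. g \<in> S \<Longrightarrow> h \<in> fun_span S \<Longrightarrow> P h \<Longrightarrow> P (\<lambda>x. c * g x + h x)"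
  shows "P f"
proof -
  from assms(1) obtain F c where F: "finite F" "F \<subseteq> S" and f: "f = (\<lambda>x. \<Sum>g\<in>F. c g * g x)"
    by (auto simp: fun_span_def)
  \<comment> \<open>Membership in the span is carried along because the hypothesis
    \<open>add\<close> may be used only for an \<open>h\<close> already known to lie there.\<close>
  from F have "(\<lambda>x. \<Sum>g\<in>F. c g * g x) \<in> fun_span S \<and> P (\<lambda>x. \<Sum>g\<in>F. c g * g x)"
  proof (induction F rule: finite_induct)
    case (insert g F)
    then show ?case
      using add[of g "\<lambda>x. \<Sum>g\<in>F. c g * g x" "c g"]
      by (simp add: fun_span_add fun_span_cmult fun_span_base)
  qed (simp add: zero)
  with f show ?thesis by simp
qed

lemma L2_closed_subspace_closure_fun_span: "L2_closed_subspace M (L2_closure M (fun_span S))"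
  by (intro L2_closed_subspace_closure fun_span_zero fun_span_add fun_span_cmult)

lemma fun_span_square_integrable:
  assumes "S \<subseteq> square_integrable_set M"
  shows "fun_span S \<subseteq> square_integrable_set M"
proof
  fix f assume "f \<in> fun_span S"
  then show "f \<in> square_integrable_set M"
  proof (induction rule: fun_span_induct)
    case (add c g h)
    then show ?case using assms by (intro square_integrable_add square_integrable_cmult) auto
  qed simp
qed

lemma L2_inner_fun_span_eq_0:
  assumes S: "S \<subseteq> square_integrable_set M" and g: "g \<in> square_integrable_set M"
    and orth: "\<And>s. s \<in> S \<Longrightarrow> L2_inner M s g = 0" and f: "f \<in> fun_span S"
  shows "L2_inner M f g = 0"
  using f
proof (induction rule: fun_span_induct)
  case (add c s h)
  have "s \<in> square_integrable_set M" "h \<in> square_integrable_set M"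
    using add.hyps S fun_span_square_integrable[OF S] by auto
  then show ?case
    using add orth by (simp add: L2_inner_add_left L2_inner_cmult_left square_integrable_cmult g)
qed simp

lemma L2_inner_fun_spans_eq_0:
  assumes S: "S \<subseteq> square_integrable_set M" and T: "T \<subseteq> square_integrable_set M"
    and orth: "\<And>s t. s \<in> S \<Longrightarrow> t \<in> T \<Longrightarrow> L2_inner M s t = 0"
    and f: "f \<in> fun_span S" and g: "g \<in> fun_span T"
  shows "L2_inner M f g = 0"
proof (rule L2_inner_fun_span_eq_0[OF S _ _ f])
  show gS: "g \<in> square_integrable_set M" using g fun_span_square_integrable[OF T] by blast
  fix s assume s: "s \<in> S"
  have "L2_inner M g s = 0"
  proof (rule L2_inner_fun_span_eq_0[OF T _ _ g])
    show "s \<in> square_integrable_set M" using s S by blast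
    show "L2_inner M t s = 0" if "t \<in> T" for t
      using orth[OF s that] by (subst L2_inner_commute) simp
  qed
  then show "L2_inner M s g = 0" by (subst L2_inner_commute) simp
qed

section \<open>The measure on the disk\<close>

lemma measurable_Complex [measurable (raw)]:
  assumes "f \<in> borel_measurable M" "g \<in> borel_measurable M"
  shows "(\<lambda>x. Complex (f x) (g x)) \<in> borel_measurable M"
proof -
  have "(\<lambda>x. Complex (f x) (g x)) = (\<lambda>x. of_real (f x) + \<i> * of_real (g x))"
    by (auto simp: complex_eq_iff)
  with assms show ?thesis by simp
qed

text \<open>Lebesgue measure is determined by the volumes of boxes, and with the basis
  \<open>1\<close>, \<open>\<i>\<close> a box in \<open>complex\<close> is a product of intervals.
  This opens the way to Fubini.\<close>

lemma distr_Complex_lborel: "distr (lborel \<Otimes>\<^sub>M lborel) borel (\<lambda>(x, y). Complex x y) = lborel"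
proof (rule lborel_eqI[symmetric])
  have [measurable]: "(\<lambda>(x, y). Complex x y) \<in> borel_measurable (lborel \<Otimes>\<^sub>M lborel)"
    unfolding case_prod_beta by measurable
  fix l u :: complex assume le: "\<And>b. b \<in> Basis \<Longrightarrow> l \<bullet> b \<le> u \<bullet> b"
  have le': "Re l \<le> Re u" "Im l \<le> Im u"
    using le[of 1] le[of \<i>] by (auto simp: Basis_complex_def)
  have box: "(\<lambda>(x, y). Complex x y) -` box l u = {Re l<..<Re u} \<times> {Im l<..<Im u}"
    by (auto simp: box_def Basis_complex_def)
  have "emeasure (distr (lborel \<Otimes>\<^sub>M lborel) borel (\<lambda>(x, y). Complex x y)) (box l u)
      = emeasure (lborel \<Otimes>\<^sub>M lborel) ({Re l<..<Re u} \<times> {Im l<..<Im u})"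
    by (subst emeasure_distr) (simp_all add: box space_pair_measure)
  also have "\<dots> = ennreal ((Re u - Re l) * (Im u - Im l))"
    using le' by (simp add: lborel.emeasure_pair_measure_Times ennreal_mult')
  also have "(Re u - Re l) * (Im u - Im l) = (\<Prod>b\<in>Basis. (u - l) \<bullet> b)"
    by (simp add: Basis_complex_def)
  finally show "emeasure (distr (lborel \<Otimes>\<^sub>M lborel) borel (\<lambda>(x, y). Complex x y)) (box l u)
      = ennreal (\<Prod>b\<in>Basis. (u - l) \<bullet> b)" .
qed simp

lemma nn_integral_lborel_complex:
  fixes f :: "complex \<Rightarrow> ennreal"
  assumes [measurable]: "f \<in> borel_measurable borel"
  shows "(\<integral>\<^sup>+z. f z \<partial>lborel) = (\<integral>\<^sup>+x. \<integral>\<^sup>+y. f (Complex x y) \<partial>lborel \<partial>lborel)"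
proof -
  have "(\<integral>\<^sup>+z. f z \<partial>lborel) = (\<integral>\<^sup>+p. f (case p of (x, y) \<Rightarrow> Complex x y) \<partial>(lborel \<Otimes>\<^sub>M lborel))"
    by (subst distr_Complex_lborel[symmetric], subst nn_integral_distr) (auto simp: case_prod_beta)
  also have "\<dots> = (\<integral>\<^sup>+x. \<integral>\<^sup>+y. f (Complex x y) \<partial>lborel \<partial>lborel)"
    by (subst lborel.nn_integral_fst[symmetric]) (auto simp: case_prod_beta)
  finally show ?thesis .
qed

text \<open>
  In the iterated integral, first \<open>x\<close> and then \<open>y\<close> is substituted affinely; both substitutions
  are nonsingular precisely if \<open>Re w \<noteq> 0\<close>.
\<close>

lemma nn_integral_lborel_rotate:
  fixes f :: "complex \<Rightarrow> ennreal"
  assumes [measurable]: "f \<in> borel_measurable borel" and w: "cmod w = 1" "Re w \<noteq> 0"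
  shows "(\<integral>\<^sup>+z. f (w * z) \<partial>lborel) = (\<integral>\<^sup>+z. f z \<partial>lborel)"
proof -
  define a b where "a = Re w" and "b = Im w"
  have a: "a \<noteq> 0" and ab: "a * a + b * b = 1"
    using w by (auto simp: a_def b_def cmod_def power2_eq_square)
  \<comment> \<open>The real part of the product becomes the new first variable. Expressed through
    it and \<open>y\<close>, the imaginary part is again affine in \<open>y\<close>, because
    \<open>a * a + b * b = 1\<close>; so each substitution changes one coordinate only.\<close>
  have wz: "w * Complex x y = Complex (- b * y + a * x) ((b * (- b * y + a * x) + y) / a)" for x y
  proof -
    have "b * (- b * y + a * x) + y = b * (- b * y + a * x) + (a * a + b * b) * y"
      by (simp add: ab)
    also have "\<dots> = a * (a * y + b * x)" by (simp add: algebra_simps)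
    finally show ?thesis using a by (simp add: complex_eq_iff a_def b_def)
  qed
  \<comment> \<open>The factor \<open>\<bar>a\<bar>\<close> is absorbed by the substitution in
    \<open>x\<close> and released again by the one in \<open>y\<close>, reflecting that a rotation
    has determinant 1. It is cancelled at the end, since it is neither zero nor infinite.\<close>
  have "ennreal \<bar>a\<bar> * (\<integral>\<^sup>+z. f (w * z) \<partial>lborel)
      = ennreal \<bar>a\<bar> * (\<integral>\<^sup>+x. \<integral>\<^sup>+y. f (w * Complex x y) \<partial>lborel \<partial>lborel)"
    by (subst nn_integral_lborel_complex) auto
  also have "\<dots> = ennreal \<bar>a\<bar> * (\<integral>\<^sup>+y. \<integral>\<^sup>+x. f (w * Complex x y) \<partial>lborel \<partial>lborel)"
    by (subst lborel_pair.Fubini') (auto simp: case_prod_beta)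
  also have "\<dots> = (\<integral>\<^sup>+y. ennreal \<bar>a\<bar> * (\<integral>\<^sup>+x. f (w * Complex x y) \<partial>lborel) \<partial>lborel)"
    by (subst nn_integral_cmult) auto
  also have "\<dots> = (\<integral>\<^sup>+y. \<integral>\<^sup>+x. f (Complex x ((b * x + y) / a)) \<partial>lborel \<partial>lborel)"
  proof (rule nn_integral_cong)
    fix y :: real
    show "ennreal \<bar>a\<bar> * (\<integral>\<^sup>+x. f (w * Complex x y) \<partial>lborel)
        = (\<integral>\<^sup>+x. f (Complex x ((b * x + y) / a)) \<partial>lborel)"
      unfolding wz
      by (rule nn_integral_real_affine[OF _ a, of "\<lambda>x. f (Complex x ((b * x + y) / a))", symmetric]) simp
  qed
  also have "\<dots> = (\<integral>\<^sup>+x. \<integral>\<^sup>+y. f (Complex x ((b * x + y) / a)) \<partial>lborel \<partial>lborel)"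
    by (subst lborel_pair.Fubini') (auto simp: case_prod_beta)
  also have "\<dots> = (\<integral>\<^sup>+x. ennreal \<bar>a\<bar> * (\<integral>\<^sup>+y. f (Complex x y) \<partial>lborel) \<partial>lborel)"
  proof (rule nn_integral_cong)
    fix x :: real
    have "(\<integral>\<^sup>+y. f (Complex x y) \<partial>lborel)
        = ennreal \<bar>1 / a\<bar> * (\<integral>\<^sup>+y. f (Complex x (b * x / a + 1 / a * y)) \<partial>lborel)"
      by (rule nn_integral_real_affine) (use a in auto)
    then have "ennreal \<bar>a\<bar> * (\<integral>\<^sup>+y. f (Complex x y) \<partial>lborel)
        = (ennreal \<bar>a\<bar> * ennreal \<bar>1 / a\<bar>) * (\<integral>\<^sup>+y. f (Complex x ((b * x + y) / a)) \<partial>lborel)"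
      by (simp add: mult.assoc add_divide_distrib)
    also have "ennreal \<bar>a\<bar> * ennreal \<bar>1 / a\<bar> = 1"
      using a by (simp add: ennreal_mult'[symmetric])
    finally show "(\<integral>\<^sup>+y. f (Complex x ((b * x + y) / a)) \<partial>lborel)
        = ennreal \<bar>a\<bar> * (\<integral>\<^sup>+y. f (Complex x y) \<partial>lborel)" by simp
  qed
  also have "\<dots> = ennreal \<bar>a\<bar> * (\<integral>\<^sup>+x. \<integral>\<^sup>+y. f (Complex x y) \<partial>lborel \<partial>lborel)"
    by (subst nn_integral_cmult) auto
  also have "\<dots> = ennreal \<bar>a\<bar> * (\<integral>\<^sup>+z. f z \<partial>lborel)"
    by (subst nn_integral_lborel_complex) auto
  finally show ?thesis using a by (simp add: ennreal_mult_cancel_left)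
qed

section \<open>The weighted measure: reduction to Borel integrals, total mass, rotation
  invariance\<close>

lemma space_disk_measure [simp]: "space (disk_measure \<alpha>) = ball 0 1"
  by (simp add: disk_measure_def)

lemma sets_disk_measure: "sets (disk_measure \<alpha>) = sets (lebesgue_on (ball 0 1))"
  by (simp add: disk_measure_def)

lemma borel_measurable_disk_measureI:
  "f \<in> borel_measurable borel \<Longrightarrow> f \<in> borel_measurable (disk_measure \<alpha>)"
  by (simp add: disk_measure_def measurable_restrict_space1 measurable_completion)

text \<open>For Borel integrands the completion and the restriction to the disk dissolve into an
  indicator under \<open>lborel\<close>, where the coordinate computations above apply.\<close>

lemma nn_integral_disk_measure:
  fixes g :: "complex \<Rightarrow> ennreal"
  assumes g: "g \<in> borel_measurable borel"
  shows "(\<integral>\<^sup>+z. g z \<partial>disk_measure \<alpha>) =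
    (\<integral>\<^sup>+z. ennreal ((\<alpha> + 1) / pi * (1 - (cmod z)\<^sup>2) powr \<alpha>) * g z * indicator (ball 0 1) z \<partial>lborel)"
  (is "_ = (\<integral>\<^sup>+z. ennreal (?w z) * _ * _ \<partial>lborel)")
proof -
  have [measurable]: "g \<in> borel_measurable lborel" "?w \<in> borel_measurable lborel"
    using g by auto
  have "(\<integral>\<^sup>+z. g z \<partial>disk_measure \<alpha>) = (\<integral>\<^sup>+z. ennreal (?w z) * g z \<partial>lebesgue_on (ball 0 1))"
    unfolding disk_measure_def
    by (rule nn_integral_density) (auto intro!: measurable_restrict_space1 measurable_completion)
  also have "\<dots> = (\<integral>\<^sup>+z. ennreal (?w z) * g z * indicator (ball 0 1) z \<partial>lebesgue)"
    by (rule nn_integral_restrict_space) simp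
  also have "\<dots> = (\<integral>\<^sup>+z. ennreal (?w z) * g z * indicator (ball 0 1) z \<partial>lborel)"
    by (rule nn_integral_completion)
  finally show ?thesis .
qed

text \<open>Stands in for polar coordinates.\<close>

lemma distr_disk_radial:
  "distr (restrict_space lborel (ball 0 1)) borel (\<lambda>z::complex. 1 - (cmod z)\<^sup>2)
    = density lborel (\<lambda>t. ennreal pi * indicator {0..1} t)" (is "?N = ?D")
proof -
  \<comment> \<open>Both measures are compared on half-lines. For \<open>x\<close> between 0 and 1
    the preimage is the disk of radius \<open>sqrt (1 - x)\<close>, whose area
    \<open>pi * (1 - x)\<close> is affine in \<open>x\<close>; hence the constant density
    \<open>pi\<close>.\<close>
  have N: "emeasure ?N {x<..} = emeasure lborel {z::complex. cmod z < 1 \<and> x < 1 - (cmod z)\<^sup>2}" for x :: real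
  proof -
    have [measurable]: "(\<lambda>z::complex. 1 - (cmod z)\<^sup>2) \<in> borel_measurable (restrict_space lborel (ball 0 1))"
      by (intro measurable_restrict_space1) simp
    have "emeasure ?N {x<..} = emeasure (restrict_space lborel (ball 0 1))
        {z::complex. cmod z < 1 \<and> x < 1 - (cmod z)\<^sup>2}"
      by (subst emeasure_distr) (auto simp: space_restrict_space intro!: arg_cong[where f="emeasure _"])
    also have "\<dots> = emeasure lborel {z::complex. cmod z < 1 \<and> x < 1 - (cmod z)\<^sup>2}"
      by (rule emeasure_restrict_space) auto
    finally show ?thesis .
  qed
  have ball: "emeasure lborel (ball (0::complex) r) = ennreal (pi * r\<^sup>2)" if "r \<ge> 0" for r
    using that by (simp add: emeasure_ball unit_ball_vol_2)
  have D: "emeasure ?D {x<..} = ennreal pi * emeasure lborel ({0..1} \<inter> {x<..})" for x :: real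
    by (simp add: emeasure_density nn_integral_cmult mult.assoc flip: indicator_inter_arith)
  \<comment> \<open>Finiteness is tracked alongside equality because the uniqueness rule
    \<open>measure_eqI_lessThan\<close> asks for it.\<close>
  have eq: "emeasure ?N {x<..} = emeasure ?D {x<..}" and fin: "emeasure ?N {x<..} < \<infinity>" for x
  proof -
    consider "x < 0" | "0 \<le> x" "x \<le> 1" | "x > 1" by linarith
    then have "emeasure ?N {x<..} = emeasure ?D {x<..} \<and> emeasure ?N {x<..} < \<infinity>"
    proof cases
      case 1
      have "x < 1 - (cmod z)\<^sup>2" if "cmod z < 1" for z
        using 1 that power_le_one[of "cmod z" 2] by simp
      then have "{z::complex. cmod z < 1 \<and> x < 1 - (cmod z)\<^sup>2} = ball 0 1" by auto
      moreover have "{0..1} \<inter> {x<..} = {0..1}" using 1 by auto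
      ultimately show ?thesis unfolding N D by (simp add: ball)
    next
      case 2
      have "{z::complex. cmod z < 1 \<and> x < 1 - (cmod z)\<^sup>2} = ball 0 (sqrt (1 - x))"
      proof (intro set_eqI)
        fix z :: complex
        have "x < 1 - (cmod z)\<^sup>2 \<longleftrightarrow> cmod z < sqrt (1 - x)"
          using 2 real_less_rsqrt[of "cmod z" "1 - x"] real_sqrt_less_iff[of "(cmod z)\<^sup>2" "1 - x"] by auto
        moreover have "sqrt (1 - x) \<le> 1" using 2 by simp
        then have "cmod z < 1" if "cmod z < sqrt (1 - x)" using that by linarith
        ultimately show "z \<in> {z. cmod z < 1 \<and> x < 1 - (cmod z)\<^sup>2} \<longleftrightarrow> z \<in> ball 0 (sqrt (1 - x))"
          by auto
      qed
      moreover have "{0..1} \<inter> {x<..} = {x<..1}" using 2 by auto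
      ultimately show ?thesis unfolding N D using 2 by (simp add: ball ennreal_mult' ennreal_mult_less_top)
    next
      case 3
      have "\<not> x < 1 - (cmod z)\<^sup>2" for z using 3 zero_le_power2[of "cmod z"] by linarith
      then have "{z::complex. cmod z < 1 \<and> x < 1 - (cmod z)\<^sup>2} = {}" by blast
      moreover have "{0..1} \<inter> {x<..} = {}" using 3 by auto
      ultimately show ?thesis unfolding N D by (simp only:) simp
    qed
    then show "emeasure ?N {x<..} = emeasure ?D {x<..}" "emeasure ?N {x<..} < \<infinity>" by auto
  qed
  show ?thesis by (rule measure_eqI_lessThan) (use fin eq in auto)
qed

text \<open>In the variable \<open>t = 1 - (cmod z)\<^sup>2\<close> the total mass is
  \<open>\<alpha> + 1\<close> times the integral of \<open>t powr \<alpha>\<close> over the unit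
  interval, and \<open>\<alpha> > -1\<close> makes this integral converge at 0.\<close>

lemma finite_measure_disk_measure:
  assumes "\<alpha> > -1"
  shows "finite_measure (disk_measure \<alpha>)"
proof
  have [measurable]: "(\<lambda>z::complex. 1 - (cmod z)\<^sup>2) \<in> borel_measurable (restrict_space lborel (ball 0 1))"
    by (intro measurable_restrict_space1) simp
  have "emeasure (disk_measure \<alpha>) (space (disk_measure \<alpha>)) = (\<integral>\<^sup>+z. 1 \<partial>disk_measure \<alpha>)"
    by simp
  also have "\<dots> = (\<integral>\<^sup>+z. ennreal ((\<alpha> + 1) / pi * (1 - (cmod z)\<^sup>2) powr \<alpha>) \<partial>restrict_space lborel (ball 0 1))"
    by (subst nn_integral_disk_measure, simp, subst nn_integral_restrict_space) auto
  also have "\<dots> = (\<integral>\<^sup>+t. ennreal ((\<alpha> + 1) / pi * t powr \<alpha>)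
      \<partial>distr (restrict_space lborel (ball 0 1)) borel (\<lambda>z::complex. 1 - (cmod z)\<^sup>2))"
    by (subst nn_integral_distr) auto
  also have "\<dots> = (\<integral>\<^sup>+t. ennreal (\<alpha> + 1) * (ennreal (t powr \<alpha>) * indicator {0..1} t) \<partial>lborel)"
    unfolding distr_disk_radial
    using assms by (subst nn_integral_density) (auto intro!: nn_integral_cong simp: ennreal_mult'[symmetric] split: split_indicator)
  also have "\<dots> = ennreal (\<alpha> + 1) * (\<integral>\<^sup>+t. ennreal (t powr \<alpha>) * indicator {0..1} t \<partial>lborel)"
    by (rule nn_integral_cmult) measurable
  also have "(\<integral>\<^sup>+t. ennreal (t powr \<alpha>) * indicator {0..1} t \<partial>lborel)
      = (\<integral>\<^sup>+t. ennreal (indicator {0..1} t * t powr \<alpha>) \<partial>lborel)"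
    by (intro nn_integral_cong) (auto split: split_indicator)
  also have "\<dots> = ennreal (integral {0..1} (\<lambda>t. t powr \<alpha>))"
    using integrable_on_powr_from_0[OF assms, of 1]
    by (intro nn_integral_has_integral_lebesgue integrable_integral) auto
  finally show "emeasure (disk_measure \<alpha>) (space (disk_measure \<alpha>)) \<noteq> \<infinity>"
    by (simp add: ennreal_mult_eq_top_iff)
qed

text \<open>Two image measures on \<open>borel\<close> are shown equal by means of nonnegative
  integrals; the complex integral then follows without splitting \<open>g\<close> into parts. The
  condition \<open>Re w \<noteq> 0\<close> is inherited from
  \<open>nn_integral_lborel_rotate\<close>.\<close>

lemma integral_disk_measure_rotate:
  fixes g :: "complex \<Rightarrow> complex"
  assumes [measurable]: "g \<in> borel_measurable borel" and w: "cmod w = 1" "Re w \<noteq> 0"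
  shows "(\<integral>z. g (w * z) \<partial>disk_measure \<alpha>) = (\<integral>z. g z \<partial>disk_measure \<alpha>)"
proof -
  have m: "(\<lambda>z. w * z) \<in> borel_measurable (disk_measure \<alpha>)" "(\<lambda>z. z) \<in> borel_measurable (disk_measure \<alpha>)"
    by (intro borel_measurable_disk_measureI; simp)+
  have "distr (disk_measure \<alpha>) borel (\<lambda>z. w * z) = distr (disk_measure \<alpha>) borel (\<lambda>z. z)"
  proof (rule measure_eqI)
    fix A assume "A \<in> sets (distr (disk_measure \<alpha>) borel (\<lambda>z. w * z))"
    then have [measurable]: "A \<in> sets borel" by simp
    let ?G = "\<lambda>z. ennreal ((\<alpha> + 1) / pi * (1 - (cmod z)\<^sup>2) powr \<alpha>) * indicator A z * indicator (ball 0 1) z"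
    \<comment> \<open>The weight and the disk depend on \<open>cmod z\<close> only, so they may be
      evaluated at \<open>u * z\<close> instead of \<open>z\<close>. The cases \<open>u = w\<close>
      and \<open>u = 1\<close> give the two measures to be compared.\<close>
    have 1: "emeasure (distr (disk_measure \<alpha>) borel (\<lambda>z. u * z)) A = (\<integral>\<^sup>+z. ?G (u * z) \<partial>lborel)"
      if u: "cmod u = 1" for u
    proof -
      have [measurable]: "(\<lambda>z. u * z) \<in> borel_measurable (disk_measure \<alpha>)"
        by (intro borel_measurable_disk_measureI) simp
      have "emeasure (distr (disk_measure \<alpha>) borel (\<lambda>z. u * z)) A
          = (\<integral>\<^sup>+z. indicator A z \<partial>distr (disk_measure \<alpha>) borel (\<lambda>z. u * z))"
        by simp
      also have "\<dots> = (\<integral>\<^sup>+z. indicator A (u * z) \<partial>disk_measure \<alpha>)"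
        by (rule nn_integral_distr) auto
      also have "\<dots> = (\<integral>\<^sup>+z. ?G (u * z) \<partial>lborel)"
        using u by (subst nn_integral_disk_measure)
          (auto intro!: nn_integral_cong simp: norm_mult split: split_indicator)
      finally show ?thesis .
    qed
    have [measurable]: "ball (0::complex) 1 \<in> sets borel" by simp
    have "(\<integral>\<^sup>+z. ?G (w * z) \<partial>lborel) = (\<integral>\<^sup>+z. ?G z \<partial>lborel)"
      by (rule nn_integral_lborel_rotate[OF _ w]) measurable
    then show "emeasure (distr (disk_measure \<alpha>) borel (\<lambda>z. w * z)) A
        = emeasure (distr (disk_measure \<alpha>) borel (\<lambda>z. z)) A"
      using 1[OF w(1)] 1[of 1] by simp
  qed simp
  then have "(\<integral>z. g z \<partial>distr (disk_measure \<alpha>) borel (\<lambda>z. w * z)) = (\<integral>z. g z \<partial>distr (disk_measure \<alpha>) borel (\<lambda>z. z))"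
    by simp
  then show ?thesis using m by (simp add: integral_distr)
qed

section \<open>Orthogonality of the monomials and of the spaces they generate\<close>

lemma borel_measurable_disk_monomial [measurable]: "disk_monomial p q \<in> borel_measurable borel"
  unfolding disk_monomial_def[abs_def] by measurable

lemma square_integrable_bounded:
  assumes "finite_measure M" "f \<in> borel_measurable M" "\<And>x. x \<in> space M \<Longrightarrow> cmod (f x) \<le> C"
  shows "f \<in> square_integrable_set M"
proof -
  interpret finite_measure M by fact
  have "integrable M (\<lambda>x. (cmod (f x))\<^sup>2)"
  proof (rule integrable_const_bound)
    show "AE x in M. norm ((cmod (f x))\<^sup>2) \<le> C\<^sup>2"
      using assms(3) by (intro AE_I2) (simp add: power_mono)
  qed (use assms(2) in measurable)
  with assms(2) show ?thesis by (simp add: square_integrable_set_def)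
qed

lemma square_integrable_disk_monomial:
  assumes "\<alpha> > -1"
  shows "disk_monomial p q \<in> square_integrable_set (disk_measure \<alpha>)"
proof (rule square_integrable_bounded[OF finite_measure_disk_measure[OF assms]])
  show "disk_monomial p q \<in> borel_measurable (disk_measure \<alpha>)"
    by (intro borel_measurable_disk_measureI) measurable
  show "cmod (disk_monomial p q z) \<le> 1" if "z \<in> space (disk_measure \<alpha>)" for z
    using that by (auto simp: disk_monomial_def norm_mult norm_power intro!: mult_le_one power_le_one)
qed

text \<open>The difference \<open>p - q\<close> is the weight of the monomial under the rotation
  group, which is why it is the degree that separates the spaces \<open>W_space\<close>.\<close>

lemma disk_monomial_rotate:
  "disk_monomial p q (cis t * z) = cis (real_of_int (int p - int q) * t) * disk_monomial p q z"
proof -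
  have "cis t ^ p * cnj (cis t) ^ q = cis (real_of_int (int p - int q) * t)"
    unfolding cis_cnj Complex.DeMoivre cis_mult by (simp add: algebra_simps)
  then show ?thesis by (simp add: disk_monomial_def power_mult_distrib mult_ac)
qed

lemma L2_inner_disk_monomial_eq_0:
  assumes ne: "int p - int q \<noteq> int p' - int q'"
  shows "L2_inner (disk_measure \<alpha>) (disk_monomial p q) (disk_monomial p' q') = 0"
proof -
  define k where "k = (int p - int q) - (int p' - int q')"
  \<comment> \<open>Rotating by the angle \<open>1 / k\<close> multiplies the inner product by \<open>cis 1 \<noteq> 1\<close>.\<close>
  define t :: real where "t = 1 / real_of_int k"
  have k: "real_of_int k \<noteq> 0" using ne by (simp add: k_def)
  \<comment> \<open>An angle of modulus at most 1 is below \<open>pi / 2\<close>, so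
    \<open>cis t\<close> has positive real part as the rotation lemma requires. The more familiar
    angle \<open>pi / k\<close> would give a purely imaginary factor when \<open>k\<close> is 2 or
    -2.\<close>
  have "\<bar>real_of_int k\<bar> \<ge> 1" using ne by (simp add: k_def flip: of_int_abs)
  then have "\<bar>t\<bar> \<le> 1" by (simp add: t_def field_simps)
  then have "cos t > 0" using pi_gt3 by (intro cos_gt_zero_pi) auto
  have "cis 1 \<noteq> 1"
    using sin_gt_zero[of 1] pi_gt3 by (auto simp: complex_eq_iff)
  let ?g = "\<lambda>z. disk_monomial p q z * cnj (disk_monomial p' q' z)"
  have kt: "cis (real_of_int (int p - int q) * t) * cnj (cis (real_of_int (int p' - int q') * t)) = cis 1"
  proof -
    have "real_of_int (int p - int q) * t + - (real_of_int (int p' - int q') * t) = real_of_int k * t"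
      by (simp add: k_def algebra_simps)
    also have "\<dots> = 1" using k by (simp add: t_def)
    finally show ?thesis by (simp add: cis_cnj cis_mult)
  qed
  have rot: "?g (cis t * z) = cis 1 * ?g z" for z
    unfolding disk_monomial_rotate kt[symmetric] by (simp add: mult_ac)
  have "(\<integral>z. ?g z \<partial>disk_measure \<alpha>) = (\<integral>z. ?g (cis t * z) \<partial>disk_measure \<alpha>)"
    using \<open>cos t > 0\<close> by (intro integral_disk_measure_rotate[symmetric]) auto
  also have "\<dots> = cis 1 * (\<integral>z. ?g z \<partial>disk_measure \<alpha>)"
    unfolding rot by simp
  finally have "(cis 1 - 1) * (\<integral>z. ?g z \<partial>disk_measure \<alpha>) = 0"
    by (simp add: algebra_simps)
  with \<open>cis 1 \<noteq> 1\<close> show ?thesis by (simp add: L2_inner_def)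
qed

lemma W_space_orthogonal:
  assumes \<alpha>: "\<alpha> > -1" and ne: "\<xi> \<noteq> \<eta>" and "f \<in> W_space \<alpha> \<xi>" "g \<in> W_space \<alpha> \<eta>"
  shows "L2_inner (disk_measure \<alpha>) f g = 0"
  using assms(3,4) unfolding W_space_def
proof (rule L2_inner_closures_eq_0)
  fix s t assume "s \<in> fun_span {disk_monomial p q |p q. int p - int q = \<xi>}"
    "t \<in> fun_span {disk_monomial p q |p q. int p - int q = \<eta>}"
  then show "L2_inner (disk_measure \<alpha>) s t = 0"
    by (rule L2_inner_fun_spans_eq_0[rotated 3])
       (use ne in \<open>auto intro!: L2_inner_disk_monomial_eq_0 square_integrable_disk_monomial \<alpha>\<close>)
qed

section \<open>Density of the polynomials\<close>

text \<open>The tool for every limit in the density argument: dominated convergence applied to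
  \<open>(cmod (f x - s n x))\<^sup>2\<close>, followed by idempotence of the closure. As only
  almost everywhere convergence is asked for, it also allows changes on null sets.\<close>

lemma L2_closure_dominated:
  assumes s: "\<And>n. s n \<in> L2_closure M S" and f: "f \<in> borel_measurable M"
    and g: "integrable M (\<lambda>x. (g x)\<^sup>2)"
    and lim: "AE x in M. (\<lambda>n. s n x) \<longlonglongrightarrow> f x" and bound: "\<And>n. AE x in M. cmod (s n x) \<le> g x"
  shows "f \<in> L2_closure M S"
proof -
  have sSQ: "s n \<in> square_integrable_set M" for n using s L2_closure_subset by blast
  have [measurable]: "s n \<in> borel_measurable M" "f \<in> borel_measurable M" for n
    using sSQ[of n] f by (auto simp: square_integrable_set_def)
  have all: "AE x in M. \<forall>n. cmod (s n x) \<le> g x" using bound by (simp add: AE_all_countable)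
  with lim have fg: "AE x in M. cmod (f x) \<le> g x"
  proof eventually_elim
    case (elim x)
    have "(\<lambda>n. cmod (s n x)) \<longlonglongrightarrow> cmod (f x)" using elim(1) by (rule tendsto_norm)
    then show ?case by (rule LIMSEQ_le_const2) (use elim(2) in auto)
  qed
  have "integrable M (\<lambda>x. (cmod (f x))\<^sup>2)"
    using g by (rule Bochner_Integration.integrable_bound)
      (measurable, use fg in eventually_elim, auto intro!: power_mono)
  then have fSQ: "f \<in> square_integrable_set M" using f by (simp add: square_integrable_set_def)
  have "(\<lambda>n. \<integral>x. (cmod (f x - s n x))\<^sup>2 \<partial>M) \<longlonglongrightarrow> (\<integral>x. 0 \<partial>M)"
  proof (rule integral_dominated_convergence)
    \<comment> \<open>The limit inherits the bound \<open>g\<close>, so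
      \<open>cmod (f x - s n x)\<close> is at most \<open>2 * g x\<close>.\<close>
    show "integrable M (\<lambda>x. 4 * (g x)\<^sup>2)" using g by simp
    show "AE x in M. (\<lambda>n. (cmod (f x - s n x))\<^sup>2) \<longlonglongrightarrow> 0"
      using lim
    proof eventually_elim
      case (elim x)
      have "(\<lambda>n. (cmod (f x - s n x))\<^sup>2) \<longlonglongrightarrow> (cmod (f x - f x))\<^sup>2"
        by (intro tendsto_intros elim)
      then show ?case by simp
    qed
    show "AE x in M. norm ((cmod (f x - s n x))\<^sup>2) \<le> 4 * (g x)\<^sup>2" for n
      using fg bound[of n]
    proof eventually_elim
      case (elim x)
      then have "cmod (f x - s n x) \<le> 2 * g x" using norm_triangle_ineq4[of "f x" "s n x"] by linarith
      then have "(cmod (f x - s n x))\<^sup>2 \<le> (2 * g x)\<^sup>2" by (intro power_mono) auto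
      then show ?case by (simp add: power_mult_distrib)
    qed
  qed measurable
  then have lim0: "(\<lambda>n. L2_norm M (\<lambda>x. f x - s n x)) \<longlonglongrightarrow> 0"
    unfolding L2_norm_def using tendsto_real_sqrt by fastforce
  have "f \<in> L2_closure M (L2_closure M S)"
    using fSQ
  proof (rule L2_closureI)
    fix e :: real assume "e > 0"
    then have "\<forall>\<^sub>F n in sequentially. L2_norm M (\<lambda>x. f x - s n x) < e"
      using lim0 by (intro order_tendstoD) auto
    then obtain n where "L2_norm M (\<lambda>x. f x - s n x) < e" by (auto simp: eventually_sequentially)
    then show "\<exists>g\<in>L2_closure M S \<inter> square_integrable_set M. L2_norm M (\<lambda>x. f x - g x) < e"
      using s sSQ by blast
  qed
  then show ?thesis by simp
qed

lemma L2_closure_fun_span_sum: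
  assumes "\<And>i. i \<in> F \<Longrightarrow> u i \<in> L2_closure M (fun_span S)"
  shows "(\<lambda>x. \<Sum>i\<in>F. u i x) \<in> L2_closure M (fun_span S)"
  using assms
proof (induction F rule: infinite_finite_induct)
  case (insert i F)
  then show ?case by (simp add: L2_closure_add[OF fun_span_add])
qed (use L2_closed_subspace_closure_fun_span[of M S] in \<open>auto simp: L2_closed_subspace_def\<close>)

text \<open>Simple functions are combinations of indicators, and \<open>f\<close> is a pointwise
  limit of simple functions bounded by \<open>2 * cmod (f x)\<close>, which is a square integrable
  dominating function.\<close>

lemma L2_closure_fun_span_eqI_indicator:
  assumes ind: "\<And>A. A \<in> sets M \<Longrightarrow> (\<lambda>x. indicator A x) \<in> L2_closure M (fun_span S)"
  shows "L2_closure M (fun_span S) = square_integrable_set M"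
proof
  show "L2_closure M (fun_span S) \<subseteq> square_integrable_set M" by (rule L2_closure_subset)
  show "square_integrable_set M \<subseteq> L2_closure M (fun_span S)"
  proof
    fix f assume f: "f \<in> square_integrable_set M"
    then have "f \<in> borel_measurable M" by (simp add: square_integrable_set_def)
    from borel_measurable_implies_sequence_metric[OF this, of 0] obtain s
      where "\<forall>i. simple_function M (s i)" "\<forall>x\<in>space M. (\<lambda>i. s i x) \<longlonglongrightarrow> f x"
        "\<forall>i. \<forall>x\<in>space M. dist (s i x) 0 \<le> 2 * dist (f x) 0"
      by (elim exE conjE)
    then have s: "\<And>i. simple_function M (s i)" "\<And>x. x \<in> space M \<Longrightarrow> (\<lambda>i. s i x) \<longlonglongrightarrow> f x"
        "\<And>i x. x \<in> space M \<Longrightarrow> cmod (s i x) \<le> 2 * cmod (f x)"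
      by simp_all
    \<comment> \<open>Agrees with \<open>s i\<close> on \<open>space M\<close> but is literally a
      combination of indicators of sets of \<open>M\<close>, the form to which \<open>ind\<close>
      applies; outside \<open>space M\<close> the two may differ.\<close>
    define t where "t i x = (\<Sum>y\<in>s i ` space M. y * indicator (s i -` {y} \<inter> space M) x)" for i x
    have t: "t i x = s i x" if "x \<in> space M" for i x
    proof -
      have "t i x = (\<Sum>y\<in>s i ` space M. if y = s i x then y else 0)"
        unfolding t_def using that by (intro sum.cong) auto
      also have "\<dots> = s i x" using simple_functionD(1)[OF s(1)] that by (subst sum.delta) auto
      finally show ?thesis .
    qed
    show "f \<in> L2_closure M (fun_span S)"
    proof (rule L2_closure_dominated)
      show "t i \<in> L2_closure M (fun_span S)" for i
        unfolding t_def
        by (intro L2_closure_fun_span_sum L2_closure_cmult[OF fun_span_cmult] ind simple_functionD(2) s)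
      show "f \<in> borel_measurable M" by fact
      show "integrable M (\<lambda>x. (2 * cmod (f x))\<^sup>2)"
        using square_integrable_integrable[OF f] by (simp add: power_mult_distrib)
      show "AE x in M. (\<lambda>i. t i x) \<longlonglongrightarrow> f x" using s(2) t by (intro AE_I2) simp
      show "AE x in M. cmod (t i x) \<le> 2 * cmod (f x)" for i using s(3) t by (intro AE_I2) simp
    qed
  qed
qed

section \<open>Polynomials in a complex variable and its conjugate\<close>

definition disk_monomials :: "(complex \<Rightarrow> complex) set" where
  "disk_monomials = {disk_monomial p q |p q. True}"

lemma disk_monomial_in_disk_monomials [simp, intro]: "disk_monomial p q \<in> disk_monomials"
  by (auto simp: disk_monomials_def)

text \<open>Exponents add under multiplication, and a span induction in each factor extends this to
  polynomials. Needed for the product case of real polynomial functions.\<close>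

lemma fun_span_disk_monomials_mult:
  assumes f: "f \<in> fun_span disk_monomials" and g: "g \<in> fun_span disk_monomials"
  shows "(\<lambda>z. f z * g z) \<in> fun_span disk_monomials" (is "_ \<in> ?P")
  using f
proof (induction rule: fun_span_induct)
  case (add c m h)
  then obtain p q where m: "m = disk_monomial p q" by (auto simp: disk_monomials_def)
  have "(\<lambda>z. m z * g z) \<in> ?P"
    using g
  proof (induction rule: fun_span_induct)
    case (add d n k)
    then obtain p' q' where n: "n = disk_monomial p' q'" by (auto simp: disk_monomials_def)
    have "(\<lambda>z. m z * n z) = disk_monomial (p + p') (q + q')"
      by (simp add: m n disk_monomial_def fun_eq_iff power_add)
    then have "(\<lambda>z. m z * n z) \<in> ?P" by (auto intro: fun_span_base)
    then have "(\<lambda>z. d * (m z * n z) + m z * k z) \<in> ?P"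
      by (intro fun_span_add fun_span_cmult add.IH)
    then show ?case by (simp add: algebra_simps)
  qed simp
  then have "(\<lambda>z. c * (m z * g z) + h z * g z) \<in> ?P"
    by (intro fun_span_add fun_span_cmult add.IH)
  then show ?case by (simp add: algebra_simps)
qed simp

lemma real_polynomial_function_fun_span:
  fixes p :: "complex \<Rightarrow> real"
  assumes "real_polynomial_function p"
  shows "(\<lambda>z. complex_of_real (p z)) \<in> fun_span disk_monomials" (is "_ \<in> ?P")
  using assms
proof (induction rule: real_polynomial_function.induct)
  case (linear f)
  interpret bounded_linear f by fact
  \<comment> \<open>A real linear \<open>f\<close> is \<open>Re z * f 1 + Im z * f \<i>\<close>;
    writing \<open>Re z\<close> and \<open>Im z\<close> through \<open>z\<close> and
    \<open>cnj z\<close> gives these two coefficients.\<close>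
  let ?a = "(complex_of_real (f 1) - \<i> * of_real (f \<i>)) / 2"
  let ?b = "(complex_of_real (f 1) + \<i> * of_real (f \<i>)) / 2"
  have "complex_of_real (f z) = ?a * disk_monomial 1 0 z + ?b * disk_monomial 0 1 z" for z
  proof -
    have "f z = f (Re z *\<^sub>R 1 + Im z *\<^sub>R \<i>)" by (rule arg_cong[of _ _ f]) (simp add: complex_eq_iff)
    also have "\<dots> = Re z * f 1 + Im z * f \<i>" by (simp only: add scaleR) simp
    finally show ?thesis by (simp add: disk_monomial_def complex_eq_iff field_simps)
  qed
  then have eq: "(\<lambda>z. complex_of_real (f z)) = (\<lambda>z. ?a * disk_monomial 1 0 z + ?b * disk_monomial 0 1 z)"
    by blast
  show ?case unfolding eq
    by (intro fun_span_add fun_span_cmult fun_span_base) auto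
next
  case (const c)
  have eq: "(\<lambda>z. complex_of_real c) = (\<lambda>z. complex_of_real c * disk_monomial 0 0 z)"
    by (simp add: disk_monomial_def)
  show ?case unfolding eq
    by (intro fun_span_cmult fun_span_base) auto
next
  case (add f g)
  then show ?case by (simp add: fun_span_add)
next
  case (mult f g)
  then show ?case by (simp add: fun_span_disk_monomials_mult)
qed

lemma polynomial_function_fun_span:
  fixes p :: "complex \<Rightarrow> complex"
  assumes "polynomial_function p"
  shows "p \<in> fun_span disk_monomials" (is "_ \<in> ?P")
proof -
  have "real_polynomial_function (Re \<circ> p)" "real_polynomial_function (Im \<circ> p)"
    using assms bounded_linear_Re bounded_linear_Im by (auto simp: polynomial_function_def)
  from this[THEN real_polynomial_function_fun_span]
  have "(\<lambda>z. complex_of_real (Re (p z)) + \<i> * complex_of_real (Im (p z))) \<in> ?P"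
    by (intro fun_span_add fun_span_cmult) (simp_all add: o_def)
  then show ?thesis by (simp add: complex_eq[symmetric])
qed

section \<open>The closure of the polynomials: from continuous functions to Lebesgue sets\<close>

context
  fixes \<alpha> :: real
  assumes \<alpha>: "\<alpha> > -1"
begin

interpretation finite_measure "disk_measure \<alpha>"
  by (rule finite_measure_disk_measure[OF \<alpha>])

text \<open>Approximation is uniform on the compact \<open>cball 0 1\<close>, which contains the
  space of the measure; since the measure is finite, uniform approximation implies approximation in
  the norm.\<close>

lemma continuous_in_closure_monomials:
  fixes f :: "complex \<Rightarrow> complex"
  assumes f: "continuous_on UNIV f"
  shows "f \<in> L2_closure (disk_measure \<alpha>) (fun_span disk_monomials)"
    (is "_ \<in> L2_closure ?M ?P")
proof -
  have "\<exists>g. polynomial_function g \<and> (\<forall>z\<in>cball 0 1. cmod (f z - g z) < 1 / real (Suc n))" for n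
    by (intro Stone_Weierstrass_polynomial_function continuous_on_subset[OF f]) auto
  then obtain g where g: "\<And>n. polynomial_function (g n)"
      "\<And>n z. cmod z \<le> 1 \<Longrightarrow> cmod (f z - g n z) < 1 / real (Suc n)"
    by (metis mem_cball_0)
  have "compact (f ` cball 0 1)"
    by (intro compact_continuous_image continuous_on_subset[OF f]) auto
  then obtain C where C: "\<And>z. cmod z \<le> 1 \<Longrightarrow> cmod (f z) \<le> C"
    by (force dest!: compact_imp_bounded simp: bounded_iff)
  show ?thesis
  proof (rule L2_closure_dominated)
    show "g n \<in> L2_closure ?M ?P" for n
    proof -
      have "g n \<in> ?P" by (rule polynomial_function_fun_span[OF g(1)])
      moreover have "?P \<subseteq> square_integrable_set ?M"
        by (rule fun_span_square_integrable) (auto simp: disk_monomials_def intro: square_integrable_disk_monomial \<alpha>)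
      ultimately show ?thesis using subset_L2_closure by blast
    qed
    show "f \<in> borel_measurable ?M"
      by (intro borel_measurable_disk_measureI borel_measurable_continuous_onI f)
    \<comment> \<open>On the closed disk \<open>f\<close> is bounded by \<open>C\<close>, and every
      approximant stays within 1 of \<open>f\<close>.\<close>
    show "integrable ?M (\<lambda>z. (C + 1)\<^sup>2)" by simp
    show "AE z in ?M. cmod (g n z) \<le> C + 1" for n
    proof (rule AE_I2)
      fix z assume "z \<in> space ?M"
      then have z: "cmod z \<le> 1" by simp
      have "1 / real (Suc n) \<le> 1" by simp
      then have "cmod (f z - g n z) < 1" using g(2)[OF z, of n] by linarith
      then show "cmod (g n z) \<le> C + 1"
        using C[OF z] norm_triangle_sub[of "g n z" "f z"] by (simp add: norm_minus_commute)
    qed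
    show "AE z in ?M. (\<lambda>n. g n z) \<longlonglongrightarrow> f z"
    proof (rule AE_I2)
      fix z assume "z \<in> space ?M"
      then have z: "cmod z \<le> 1" by simp
      have "(\<lambda>n. g n z - f z) \<longlonglongrightarrow> 0"
      proof (rule Lim_null_comparison)
        show "\<forall>\<^sub>F n in sequentially. norm (g n z - f z) \<le> 1 / real (Suc n)"
          using g(2)[OF z] by (intro always_eventually allI less_imp_le) (simp add: norm_minus_commute)
        show "(\<lambda>n. 1 / real (Suc n)) \<longlonglongrightarrow> 0"
          using LIMSEQ_inverse_real_of_nat by (simp add: inverse_eq_divide)
      qed
      then show "(\<lambda>n. g n z) \<longlonglongrightarrow> f z" by (simp add: LIM_zero_iff)
    qed
  qed
qed

lemma indicator_open_in_closure_monomials: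
  assumes U: "open U"
  shows "(\<lambda>z. indicator U z) \<in> L2_closure (disk_measure \<alpha>) (fun_span disk_monomials)"
    (is "_ \<in> L2_closure ?M ?P")
\<comment> \<open>The whole plane is treated apart because \<open>infdist\<close> to the empty set
  is 0 by convention, which would make the approximating functions vanish.\<close>
proof (cases "U = UNIV")
  case True
  then show ?thesis using continuous_in_closure_monomials[of "\<lambda>z. 1"] by simp
next
  case False
  \<comment> \<open>Continuous functions that vanish off \<open>U\<close> and reach 1 at each point
    of \<open>U\<close> once \<open>n\<close> exceeds the reciprocal of its distance to the
    complement.\<close>
  define s where "s n z = complex_of_real (min 1 (real n * infdist z (- U)))" for n :: nat and z
  show ?thesis
  proof (rule L2_closure_dominated)
    show "s n \<in> L2_closure ?M ?P" for n
      unfolding s_def[abs_def] by (intro continuous_in_closure_monomials continuous_intros)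
    show "(\<lambda>z. indicator U z) \<in> borel_measurable ?M"
      using U by (intro borel_measurable_disk_measureI borel_measurable_indicator) auto
    show "integrable ?M (\<lambda>z. 1\<^sup>2)" by simp
    show "AE z in ?M. cmod (s n z) \<le> 1" for n
      by (intro AE_I2) (auto simp: s_def infdist_nonneg)
    show "AE z in ?M. (\<lambda>n. s n z) \<longlonglongrightarrow> indicator U z"
    proof (rule AE_I2)
      fix z
      show "(\<lambda>n. s n z) \<longlonglongrightarrow> indicator U z"
      proof (cases "z \<in> U")
        case True
        have "infdist z (- U) > 0"
          using infdist_pos_not_in_closed[of "- U" z] U False True by auto
        then obtain N :: nat where N: "1 < real N * infdist z (- U)"
          using reals_Archimedean3 by blast
        have "s n z = 1" if "n \<ge> N" for n
        proof -
          have "real N * infdist z (- U) \<le> real n * infdist z (- U)"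
            using that by (intro mult_right_mono) (auto simp: infdist_nonneg)
          with N show ?thesis by (simp add: s_def)
        qed
        then have "\<forall>\<^sub>F n in sequentially. s n z = indicator U z"
          using True by (auto simp: eventually_sequentially)
        then show ?thesis by (rule tendsto_eventually)
      next
        case False
        then show ?thesis by (simp add: s_def)
      qed
    qed
  qed
qed

text \<open>Dynkin's argument: open sets are stable under intersection, so only complements and
  disjoint unions need treatment. These correspond to differences and sums of indicators, whereas
  products of functions in the closure are never formed.\<close>

lemma indicator_borel_in_closure_monomials:
  assumes A: "A \<in> sets borel"
  shows "(\<lambda>z. indicator A z) \<in> L2_closure (disk_measure \<alpha>) (fun_span disk_monomials)"
    (is "_ \<in> L2_closure ?M ?P")
proof -
  have borel: "sigma_sets UNIV {S. open S} = sets (borel :: complex measure)"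
    by (simp add: borel_def)
  have "Int_stable {S::complex set. open S}" by (auto simp: Int_stable_def)
  moreover have "{S::complex set. open S} \<subseteq> Pow UNIV" by simp
  moreover have "A \<in> sigma_sets UNIV {S. open S}" using A by (simp add: borel)
  ultimately show ?thesis
  proof (induction rule: sigma_sets_induct_disjoint)
    case (basic A)
    then show ?case by (simp add: indicator_open_in_closure_monomials)
  next
    case empty
    then show ?case using indicator_open_in_closure_monomials[of "{}"] by simp
  next
    case (compl A)
    have "(\<lambda>z. (-1) * indicator A z) \<in> L2_closure ?M ?P"
      by (intro L2_closure_cmult fun_span_cmult compl)
    from L2_closure_add[OF fun_span_add indicator_open_in_closure_monomials[OF open_UNIV] this]
    have "(\<lambda>z. indicator UNIV z + (-1) * indicator A z) \<in> L2_closure ?M ?P" .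
    moreover have "(\<lambda>z. indicator UNIV z + (-1) * indicator A z) = (\<lambda>z. indicator (UNIV - A) z :: complex)"
      by (rule ext) (simp add: indicator_def)
    ultimately show ?case by simp
  next
    case (union A)
    show ?case
    proof (rule L2_closure_dominated)
      show "(\<lambda>z. \<Sum>i<n. indicator (A i) z) \<in> L2_closure ?M ?P" for n
        by (intro L2_closure_fun_span_sum union)
      \<comment> \<open>Disjointness keeps the partial sums bounded by 1, so a constant dominates
        them.\<close>
      have ind: "(\<Sum>i<n. indicator (A i) z) = (indicator (\<Union>i<n. A i) z :: complex)" for n z
        using union(1) by (intro indicator_UN_disjoint[symmetric]) (auto simp: disjoint_family_on_def)
      show "AE z in ?M. (\<lambda>n. \<Sum>i<n. indicator (A i) z) \<longlonglongrightarrow> (indicator (\<Union>i. A i) z :: complex)"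
        unfolding ind by (intro AE_I2 LIMSEQ_indicator_UN)
      show "AE z in ?M. cmod (\<Sum>i<n. indicator (A i) z) \<le> 1" for n
        unfolding ind by (intro AE_I2) (simp add: indicator_def)
      show "integrable ?M (\<lambda>z. 1\<^sup>2)" by simp
      show "(\<lambda>z. indicator (\<Union>i. A i) z) \<in> borel_measurable ?M"
        using union(2) by (intro borel_measurable_disk_measureI borel_measurable_indicator) (auto simp: borel)
    qed
  qed
qed

lemma closure_monomials:
  "L2_closure (disk_measure \<alpha>) (fun_span disk_monomials) = square_integrable_set (disk_measure \<alpha>)"
    (is "L2_closure ?M ?P = _")
proof (rule L2_closure_fun_span_eqI_indicator)
  fix A assume A: "A \<in> sets ?M"
  then have "A \<in> sets lebesgue"
    by (auto simp: sets_disk_measure sets_restrict_space)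
  then obtain S N N' where S: "A = S \<union> N" "N \<subseteq> N'" "N' \<in> null_sets lborel" "S \<in> sets lborel"
    by (rule sets_completionE)
  have "AE z in lebesgue. z \<notin> N'"
    using S(3) by (intro AE_not_in null_sets_completionI)
  then have "AE z in lebesgue_on (ball 0 1). z \<notin> N'"
    by (subst AE_restrict_space_iff) auto
  then have N': "AE z in ?M. z \<notin> N'"
    unfolding disk_measure_def
    by (subst AE_density) (auto intro!: measurable_restrict_space1 measurable_completion)
  show "(\<lambda>z. indicator A z) \<in> L2_closure ?M ?P"
  \<comment> \<open>Used with the constant sequence \<open>indicator S\<close>: the Borel set
    \<open>S\<close> differs from \<open>A\<close> only inside the null set \<open>N'\<close>, and
    this difference is absorbed by the almost everywhere limit.\<close>
  proof (rule L2_closure_dominated)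
    show "(\<lambda>z. indicator S z) \<in> L2_closure ?M ?P"
      using S(4) by (intro indicator_borel_in_closure_monomials) simp
    show "(\<lambda>z. indicator A z) \<in> borel_measurable ?M" using A by simp
    show "integrable ?M (\<lambda>z. 1\<^sup>2)" by simp
    show "AE z in ?M. cmod (indicator S z) \<le> 1" by (intro AE_I2) (simp add: indicator_def)
    show "AE z in ?M. (\<lambda>n::nat. indicator S z) \<longlonglongrightarrow> (indicator A z :: complex)"
      using N'
    proof eventually_elim
      case (elim z)
      then have "indicator A z = (indicator S z :: complex)" using S by (auto simp: indicator_def)
      then show ?case by simp
    qed
  qed
qed

end

text \<open>Sorts a polynomial by degree. The family \<open>u\<close> is defined at every integer
  and vanishes off \<open>F\<close>, so that adding a monomial needs no distinction of whether its
  degree has occurred before.\<close>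

lemma monomials_decompose:
  assumes \<alpha>: "\<alpha> > -1" and f: "f \<in> fun_span disk_monomials"
  shows "\<exists>F u. finite F \<and> (\<forall>i. u i \<in> W_space \<alpha> i) \<and> (\<forall>i. i \<notin> F \<longrightarrow> u i = (\<lambda>z. 0))
    \<and> f = (\<lambda>z. \<Sum>i\<in>F. u i z)"
  using f
proof (induction rule: fun_span_induct)
  case zero
  have "(\<lambda>z. 0) \<in> W_space \<alpha> i" for i
    using L2_closed_subspace_closure_fun_span by (auto simp: W_space_def L2_closed_subspace_def)
  then show ?case by (intro exI[of _ "{}"] exI[of _ "\<lambda>i z. 0"]) auto
next
  case (add c m h)
  then obtain p q F u where m: "m = disk_monomial p q" and F: "finite F"
      and u: "\<And>i. u i \<in> W_space \<alpha> i" "\<And>i. i \<notin> F \<Longrightarrow> u i = (\<lambda>z. 0)"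
      and h: "h = (\<lambda>z. \<Sum>i\<in>F. u i z)"
    by (auto simp: disk_monomials_def)
  define \<xi> where "\<xi> = int p - int q"
  \<comment> \<open>If \<open>\<xi>\<close> is new, \<open>u \<xi>\<close> is zero and the new
    component is the monomial term alone; otherwise the term joins the existing component.\<close>
  define v where "v = u(\<xi> := (\<lambda>z. c * m z + u \<xi> z))"
  have "m \<in> W_space \<alpha> \<xi>"
    unfolding W_space_def m
    using square_integrable_disk_monomial[OF \<alpha>]
    by (intro subsetD[OF subset_L2_closure] IntI fun_span_base) (auto simp: \<xi>_def)
  then have v: "v i \<in> W_space \<alpha> i" for i
    using u unfolding v_def W_space_def
    by (auto intro!: L2_closure_add L2_closure_cmult fun_span_add fun_span_cmult)
  have "(\<Sum>i\<in>insert \<xi> F. v i z) = c * m z + h z" for z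
  proof -
    have "(\<Sum>i\<in>insert \<xi> F. v i z) = (c * m z + u \<xi> z) + (\<Sum>i\<in>F - {\<xi>}. u i z)"
      using F by (simp add: sum.insert_remove v_def)
    also have "\<dots> = c * m z + (\<Sum>i\<in>insert \<xi> F. u i z)"
      using F by (simp add: sum.insert_remove)
    also have "(\<Sum>i\<in>insert \<xi> F. u i z) = h z"
      unfolding h using F u(2) by (intro sum.mono_neutral_right) auto
    finally show ?thesis .
  qed
  then show ?case
    using F u v by (intro exI[of _ "insert \<xi> F"] exI[of _ v]) (auto simp: v_def)
qed

theorem corollary3p6:
  fixes \<alpha> :: real
  assumes "\<alpha> > -1"
  shows "L2_orthogonal_sum (disk_measure \<alpha>) (UNIV :: int set) (W_space \<alpha>)"
proof (rule L2_orthogonal_sumI_dense)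
  show "L2_closed_subspace (disk_measure \<alpha>) (W_space \<alpha> i)" for i
    unfolding W_space_def by (rule L2_closed_subspace_closure_fun_span)
  show "L2_inner (disk_measure \<alpha>) f g = 0"
    if "i \<noteq> j" "f \<in> W_space \<alpha> i" "g \<in> W_space \<alpha> j" for i j f g
    using assms that by (rule W_space_orthogonal)
  fix f e assume "f \<in> square_integrable_set (disk_measure \<alpha>)" and e: "(e::real) > 0"
  then have "f \<in> L2_closure (disk_measure \<alpha>) (fun_span disk_monomials)"
    by (simp add: closure_monomials[OF assms])
  then obtain g where g: "g \<in> fun_span disk_monomials"
      "L2_norm (disk_measure \<alpha>) (\<lambda>x. f x - g x) < e"
    using e by (rule L2_closureE)
  from monomials_decompose[OF assms g(1)] g(2)
  show "\<exists>F u. finite F \<and> F \<subseteq> UNIV \<and> (\<forall>i\<in>F. u i \<in> W_space \<alpha> i)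
      \<and> L2_norm (disk_measure \<alpha>) (\<lambda>x. f x - (\<Sum>i\<in>F. u i x)) < e"
    by blast
qed

end
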